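(* Let $m\ge1$ and $\ell\ge1$. Every bounded multilinear form $\Upsilon:\bigl(D([0,1]^m)\bigr)^\ell\to\mathbb R$ is measurable (with respect to the product $\sigma$-field on $\bigl(D([0,1]^m)\bigr)^\ell$ obtained from the $\sigma$-field $\mathcal D$ on each factor, and the Borel $\sigma$-field on $\mathbb R$).
   Context: $D([0,1]^m)$ is the set of functions $f:[0,1]^m\to\mathbb R$ such that at every $t=(t_1,\dots,t_m)\in[0,1]^m$ the limit of $f(s)$ exists (as a finite real number) as $s\to t$ within each set $J_1\times\dots\times J_m$, where each $J_i$ is either $[t_i,1]$ or $[0,t_i)$ (the latter only if $t_i>0$). It is a Banach space with the norm $\|f\|=\sup_{t\in[0,1]^m}|f(t)|$. $\mathcal D$ is the $\sigma$-field on $D([0,1]^m)$ generated by all point evaluations $f\mapsto f(t)$, $t\in[0,1]^m$. *)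

theory Defs
  imports "HOL-Analysis.Analysis"
begin

section \<open>The space \<open>D([0,1]\<^sup>m)\<close>\<close>

text \<open>
  The cube \<open>[0,1]\<^sup>m\<close> is \<open>cbox 0 1\<close> in \<open>real ^ 'm\<close>, with \<open>m = CARD('m)\<close>.

  The limits are taken along the filter \<open>inf (nhds t) (principal S)\<close> and not along
  \<open>at t within S\<close>: the point \<open>t\<close> itself is not excluded when it lies in \<open>S\<close>, which
  happens exactly when every factor is \<open>[t\<^sub>i, 1]\<close>. There the limit is therefore \<open>f t\<close>;
  for \<open>m = 1\<close> the functions are the right-continuous functions with left limits.
\<close>

definition quadrants :: "real ^ 'm \<Rightarrow> (real ^ 'm) set set" where
  "quadrants t = {{s. \<forall>i. s $ i \<in> J i} | J.
     \<forall>i. J i = {t $ i..1} \<or> (0 < t $ i \<and> J i = {0..<t $ i})}"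

definition has_quadrant_limits :: "(real ^ 'm \<Rightarrow> real) \<Rightarrow> bool" where
  "has_quadrant_limits f \<longleftrightarrow>
     (\<forall>t\<in>cbox 0 1. \<forall>S\<in>quadrants t. \<exists>L. (f \<longlongrightarrow> L) (inf (nhds t) (principal S)))"

lemma has_quadrant_limits_add:
  fixes f g :: "real ^ 'm \<Rightarrow> real"
  assumes "has_quadrant_limits f" "has_quadrant_limits g"
  shows "has_quadrant_limits (\<lambda>t. f t + g t)"
  unfolding has_quadrant_limits_def
proof (intro ballI)
  fix t :: "real ^ 'm" and S assume "t \<in> cbox 0 1" "S \<in> quadrants t"
  then obtain K L where "(f \<longlongrightarrow> K) (inf (nhds t) (principal S))" "(g \<longlongrightarrow> L) (inf (nhds t) (principal S))"
    using assms unfolding has_quadrant_limits_def by blast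
  then show "\<exists>L. ((\<lambda>t. f t + g t) \<longlongrightarrow> L) (inf (nhds t) (principal S))"
    by (blast intro: tendsto_add)
qed

lemma has_quadrant_limits_cmult:
  fixes f :: "real ^ 'm \<Rightarrow> real"
  assumes "has_quadrant_limits f"
  shows "has_quadrant_limits (\<lambda>t. c * f t)"
  unfolding has_quadrant_limits_def
proof (intro ballI)
  fix t :: "real ^ 'm" and S assume "t \<in> cbox 0 1" "S \<in> quadrants t"
  then obtain L where "(f \<longlongrightarrow> L) (inf (nhds t) (principal S))"
    using assms unfolding has_quadrant_limits_def by blast
  then show "\<exists>L. ((\<lambda>t. c * f t) \<longlongrightarrow> L) (inf (nhds t) (principal S))"
    by (blast intro: tendsto_mult_left)
qed

lemma quadrants_subset:
  assumes "t \<in> cbox 0 1" "S \<in> quadrants t"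
  shows "S \<subseteq> cbox 0 (1 :: real ^ 'm)"
proof
  fix s assume "s \<in> S"
  from assms(2) obtain J where J: "S = {s. \<forall>i. s $ i \<in> J i}"
    "\<And>i. J i = {t $ i..1} \<or> (0 < t $ i \<and> J i = {0..<t $ i})"
    by (auto simp: quadrants_def)
  have "0 \<le> s $ i \<and> s $ i \<le> 1" for i
  proof -
    have "s $ i \<in> J i" "0 \<le> t $ i" "t $ i \<le> 1"
      using \<open>s \<in> S\<close> assms(1) by (auto simp: J(1) mem_box_cart)
    then show ?thesis using J(2)[of i] by auto
  qed
  then show "s \<in> cbox 0 1" by (simp add: mem_box_cart)
qed

lemma finite_quadrants: "finite (quadrants (t :: real ^ 'm))"
proof -
  have "quadrants t \<subseteq> range (\<lambda>A. {s. \<forall>i. s $ i \<in> (if i \<in> A then {0..<t $ i} else {t $ i..1})})"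
  proof
    fix S assume "S \<in> quadrants t"
    then obtain J where S: "S = {s. \<forall>i. s $ i \<in> J i}"
      and J: "\<And>i. J i = {t $ i..1} \<or> (0 < t $ i \<and> J i = {0..<t $ i})"
      by (auto simp: quadrants_def)
    have "J i = (if i \<in> {i. J i = {0..<t $ i}} then {0..<t $ i} else {t $ i..1})" for i
      using J[of i] by auto
    then show "S \<in> range (\<lambda>A. {s. \<forall>i. s $ i \<in> (if i \<in> A then {0..<t $ i} else {t $ i..1})})"
      unfolding S by (intro image_eqI[of _ _ "{i. J i = {0..<t $ i}}"]) simp_all
  qed
  then show ?thesis by (rule finite_subset) simp
qed

lemma quadrants_cover:
  assumes "s \<in> cbox 0 (1 :: real ^ 'm)"
  shows "\<exists>S\<in>quadrants t. s \<in> S"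
proof -
  define J where "J i = (if s $ i < t $ i then {0..<t $ i} else {t $ i..1})" for i
  have s: "0 \<le> s $ i" "s $ i \<le> 1" for i
    using assms by (auto simp: mem_box_cart)
  have "J i = {t $ i..1} \<or> (0 < t $ i \<and> J i = {0..<t $ i})" for i
    using s[of i] by (auto simp: J_def)
  then have "{s. \<forall>i. s $ i \<in> J i} \<in> quadrants t"
    unfolding quadrants_def by blast
  moreover have "s $ i \<in> J i" for i
    using s[of i] by (auto simp: J_def)
  ultimately show ?thesis by (intro bexI[of _ "{s. \<forall>i. s $ i \<in> J i}"]) simp_all
qed

lemma has_quadrant_limits_bounded:
  assumes "has_quadrant_limits (f :: real ^ 'm \<Rightarrow> real)"
  shows "bounded (f ` cbox 0 1)"
proof -
  have loc: "\<exists>U B. open U \<and> t \<in> U \<and> (\<forall>s\<in>U \<inter> cbox 0 1. \<bar>f s\<bar> \<le> B)"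
    if t: "t \<in> cbox 0 1" for t
  proof -
    have "\<exists>B. \<forall>\<^sub>F s in nhds t. s \<in> S \<longrightarrow> \<bar>f s\<bar> \<le> B" if S: "S \<in> quadrants t" for S
    proof -
      obtain L where "(f \<longlongrightarrow> L) (inf (nhds t) (principal S))"
        using assms t S unfolding has_quadrant_limits_def by blast
      from tendstoD[OF this, of 1] have "\<forall>\<^sub>F s in nhds t. s \<in> S \<longrightarrow> dist (f s) L < 1"
        by (simp add: eventually_inf_principal)
      then have "\<forall>\<^sub>F s in nhds t. s \<in> S \<longrightarrow> \<bar>f s\<bar> \<le> \<bar>L\<bar> + 1"
        by (rule eventually_mono) (auto simp: dist_real_def)
      then show ?thesis by blast
    qed
    then obtain B where B: "\<And>S. S \<in> quadrants t \<Longrightarrow> \<forall>\<^sub>F s in nhds t. s \<in> S \<longrightarrow> \<bar>f s\<bar> \<le> B S"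
      by metis
    then have "\<forall>\<^sub>F s in nhds t. \<forall>S\<in>quadrants t. s \<in> S \<longrightarrow> \<bar>f s\<bar> \<le> B S"
      by (intro eventually_ball_finite finite_quadrants) auto
    then obtain U where U: "open U" "t \<in> U"
      "\<And>s S. s \<in> U \<Longrightarrow> S \<in> quadrants t \<Longrightarrow> s \<in> S \<Longrightarrow> \<bar>f s\<bar> \<le> B S"
      unfolding eventually_nhds by blast
    have "\<bar>f s\<bar> \<le> Max (B ` quadrants t)" if s: "s \<in> U \<inter> cbox 0 1" for s
    proof -
      obtain S where S: "S \<in> quadrants t" "s \<in> S" using quadrants_cover s by blast
      then have "\<bar>f s\<bar> \<le> B S" using U(3) s by blast
      also have "\<dots> \<le> Max (B ` quadrants t)" using S finite_quadrants by (intro Max_ge) auto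
      finally show ?thesis .
    qed
    then show ?thesis using U by blast
  qed
  then obtain U B where UB: "\<And>t. t \<in> cbox 0 1 \<Longrightarrow> open (U t)" "\<And>t. t \<in> cbox 0 1 \<Longrightarrow> t \<in> U t"
    "\<And>t s. t \<in> cbox 0 1 \<Longrightarrow> s \<in> U t \<inter> cbox 0 1 \<Longrightarrow> \<bar>f s\<bar> \<le> B t"
    by metis
  obtain C where C: "C \<subseteq> cbox 0 (1 :: real ^ 'm)" "finite C" "cbox 0 (1 :: real ^ 'm) \<subseteq> (\<Union>c\<in>C. U c)"
    using compactE_image[OF compact_cbox, of "cbox 0 (1 :: real ^ 'm)" U 0 1] UB(1,2)
    by (metis UN_I subsetI)
  have "bounded (f ` (\<Union>c\<in>C. U c \<inter> cbox 0 1))"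
    unfolding image_UN
  proof (intro bounded_UN ballI C(2))
    fix c assume "c \<in> C"
    then show "bounded (f ` (U c \<inter> cbox 0 1))"
      using UB(3)[of c] C(1) by (intro boundedI[of _ "B c"]) (auto simp: subset_iff)
  qed
  then show ?thesis by (rule bounded_subset) (use C(3) in auto)
qed

text \<open>
  A function on the cube is represented by its extension by \<open>0\<close> to all of \<open>real ^ 'm\<close>, so
  that the elements of the type correspond one-to-one to the functions on the cube.
\<close>

typedef (overloaded) ('m::finite) dspace =
  "{f :: real ^ 'm \<Rightarrow> real. has_quadrant_limits f \<and> (\<forall>t. t \<notin> cbox 0 1 \<longrightarrow> f t = 0)}"
  morphisms apply_dspace Dspace
  by (rule exI[of _ "\<lambda>_. 0"]) (auto simp: has_quadrant_limits_def)

setup_lifting type_definition_dspace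

lemma dspace_eqI: "(\<And>t. t \<in> cbox 0 1 \<Longrightarrow> apply_dspace f t = apply_dspace g t) \<Longrightarrow> f = g"
  by transfer (force simp: fun_eq_iff)

instantiation dspace :: (finite) real_vector
begin

lift_definition zero_dspace :: "'a dspace" is "\<lambda>_. 0"
  by (auto simp: has_quadrant_limits_def)

lift_definition plus_dspace :: "'a dspace \<Rightarrow> 'a dspace \<Rightarrow> 'a dspace" is "\<lambda>f g t. f t + g t"
  by (simp add: has_quadrant_limits_add)

lift_definition minus_dspace :: "'a dspace \<Rightarrow> 'a dspace \<Rightarrow> 'a dspace" is "\<lambda>f g t. f t - g t"
  by (use has_quadrant_limits_add[OF _ has_quadrant_limits_cmult[of _ "-1"]] in force)

lift_definition uminus_dspace :: "'a dspace \<Rightarrow> 'a dspace" is "\<lambda>f t. - f t"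
  by (use has_quadrant_limits_cmult[of _ "-1"] in force)

lift_definition scaleR_dspace :: "real \<Rightarrow> 'a dspace \<Rightarrow> 'a dspace" is "\<lambda>c f t. c * f t"
  by (simp add: has_quadrant_limits_cmult)

lemmas [simp] =
  zero_dspace.rep_eq plus_dspace.rep_eq minus_dspace.rep_eq uminus_dspace.rep_eq
  scaleR_dspace.rep_eq

instance
  by standard (auto intro!: dspace_eqI simp: algebra_simps)

end

instantiation dspace :: (finite) real_normed_vector
begin

definition norm_dspace :: "'a dspace \<Rightarrow> real" where
  "norm f = (SUP t\<in>cbox 0 1. \<bar>apply_dspace f t\<bar>)"

definition dist_dspace :: "'a dspace \<Rightarrow> 'a dspace \<Rightarrow> real" where
  "dist (f :: 'a dspace) g = norm (f - g)"

definition sgn_dspace :: "'a dspace \<Rightarrow> 'a dspace" where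
  "sgn (f :: 'a dspace) = f /\<^sub>R norm f"

definition uniformity_dspace :: "('a dspace \<times> 'a dspace) filter" where
  "uniformity = (INF e\<in>{0<..}. principal {(f :: 'a dspace, g). dist f g < e})"

definition open_dspace :: "'a dspace set \<Rightarrow> bool" where
  "open (U :: 'a dspace set) \<longleftrightarrow> (\<forall>f\<in>U. eventually (\<lambda>(f', g). f' = f \<longrightarrow> g \<in> U) uniformity)"

lemma bdd_above_dspace: "bdd_above ((\<lambda>t. \<bar>apply_dspace f t\<bar>) ` cbox 0 1)"
proof -
  have "bounded (apply_dspace f ` cbox 0 1)"
    using apply_dspace[of f] by (intro has_quadrant_limits_bounded) auto
  then show ?thesis by (force simp: bounded_iff bdd_above_def)
qed

lemma norm_dspace_ge: "\<bar>apply_dspace f t\<bar> \<le> norm f" for f :: "'a dspace"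
proof -
  have le: "\<bar>apply_dspace f s\<bar> \<le> norm f" if "s \<in> cbox 0 1" for s
    unfolding norm_dspace_def using that by (intro cSUP_upper bdd_above_dspace)
  have "0 \<le> norm f" using le[of 0] by (auto simp: mem_box_cart)
  then show ?thesis
    using le[of t] apply_dspace[of f] by (cases "t \<in> cbox 0 1") auto
qed

lemma norm_dspace_le:
  "(\<And>t. t \<in> cbox 0 1 \<Longrightarrow> \<bar>apply_dspace f t\<bar> \<le> B) \<Longrightarrow> norm f \<le> B" for f :: "'a dspace"
  unfolding norm_dspace_def
  by (intro cSUP_least) (auto simp: set_eq_iff mem_box_cart intro: exI[of _ 0])

instance
proof
  fix f g :: "'a dspace" and c :: real
  show "norm f = 0 \<longleftrightarrow> f = 0"
  proof
    assume "norm f = 0"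
    then show "f = 0" using norm_dspace_ge[of f] by (intro dspace_eqI) auto
  next
    assume "f = 0"
    then have "norm f \<le> 0" by (intro norm_dspace_le) auto
    moreover have "0 \<le> norm f" using norm_dspace_ge[of f 0] by linarith
    ultimately show "norm f = 0" by simp
  qed
  show "norm (f + g) \<le> norm f + norm g"
  proof (rule norm_dspace_le)
    fix t
    show "\<bar>apply_dspace (f + g) t\<bar> \<le> norm f + norm g"
      using norm_dspace_ge[of f t] norm_dspace_ge[of g t] by simp
  qed
  have scale: "norm (b *\<^sub>R h) \<le> \<bar>b\<bar> * norm h" for b and h :: "'a dspace"
    by (rule norm_dspace_le) (simp add: abs_mult mult_left_mono norm_dspace_ge)
  show "norm (c *\<^sub>R f) = \<bar>c\<bar> * norm f"
  proof (cases "c = 0")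
    case True
    then show ?thesis using scale[of 0 f] norm_dspace_ge[of "0 *\<^sub>R f" 0] by simp
  next
    case False
    have "\<bar>c\<bar> * norm f = \<bar>c\<bar> * norm (inverse c *\<^sub>R (c *\<^sub>R f))" using False by simp
    also have "\<dots> \<le> \<bar>c\<bar> * (\<bar>inverse c\<bar> * norm (c *\<^sub>R f))"
      by (intro mult_left_mono scale) simp
    also have "\<dots> = norm (c *\<^sub>R f)" using False by simp
    finally show ?thesis using scale[of c f] by linarith
  qed
qed (simp_all add: dist_dspace_def sgn_dspace_def uniformity_dspace_def open_dspace_def)

end

instance dspace :: (finite) banach
proof
  fix F :: "nat \<Rightarrow> 'a dspace"
  assume "Cauchy F"
  have dist_le: "\<bar>apply_dspace f t - apply_dspace g t\<bar> \<le> dist f g" for f g :: "'a dspace" and t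
    using norm_dspace_ge[of "f - g" t] by (simp add: dist_norm)
  have "uniformly_Cauchy_on UNIV (\<lambda>n. apply_dspace (F n))"
    unfolding uniformly_Cauchy_on_def dist_real_def
    using \<open>Cauchy F\<close> dist_le unfolding Cauchy_def by (meson le_less_trans)
  then obtain g where g: "uniform_limit UNIV (\<lambda>n. apply_dspace (F n)) g sequentially"
    using Cauchy_uniformly_convergent uniformly_convergent_on_def by blast
  have ptw: "(\<lambda>n. apply_dspace (F n) t) \<longlonglongrightarrow> g t" for t
    using tendsto_uniform_limitI[OF g] by simp
  have "g t = 0" if "t \<notin> cbox 0 1" for t
  proof -
    have "apply_dspace (F n) t = 0" for n using apply_dspace[of "F n"] that by auto
    then show ?thesis using ptw[of t] LIMSEQ_unique[of "\<lambda>_. 0::real" "g t" 0] by simp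
  qed
  moreover have "has_quadrant_limits g"
    unfolding has_quadrant_limits_def
  proof (intro ballI)
    fix t :: "real ^ 'a" and S assume tS: "t \<in> cbox 0 1" "S \<in> quadrants t"
    let ?A = "inf (nhds t) (principal S)"
    show "\<exists>L. (g \<longlongrightarrow> L) ?A"
    proof (cases "?A = bot")
      case False
      have "\<exists>L. (apply_dspace (F n) \<longlongrightarrow> L) ?A" for n
        using apply_dspace[of "F n"] tS by (auto simp: has_quadrant_limits_def)
      then obtain L where L: "\<And>n. (apply_dspace (F n) \<longlongrightarrow> L n) ?A" by metis
      have "\<bar>L n - L k\<bar> \<le> dist (F n) (F k)" for n k
        by (rule tendsto_upperbound[OF tendsto_rabs[OF tendsto_diff[OF L L]]])
          (use False dist_le in \<open>auto intro: always_eventually\<close>)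
      then have "Cauchy L"
        using \<open>Cauchy F\<close> unfolding Cauchy_def dist_real_def by (meson le_less_trans)
      then obtain l where l: "L \<longlonglongrightarrow> l" using Cauchy_convergent convergent_def by blast
      have "(g \<longlongrightarrow> l) ?A"
      proof (rule tendstoI)
        fix e :: real assume e: "e > 0"
        have "\<forall>\<^sub>F n in sequentially. (\<forall>s\<in>UNIV. dist (apply_dspace (F n) s) (g s) < e / 3) \<and> dist (L n) l < e / 3"
          using uniform_limitD[OF g, of "e / 3"] tendstoD[OF l, of "e / 3"] e
          by (intro eventually_conj) auto
        then obtain n where n: "\<And>s. dist (apply_dspace (F n) s) (g s) < e / 3" "dist (L n) l < e / 3"
          by (auto simp: eventually_sequentially)
        have "\<forall>\<^sub>F s in ?A. dist (apply_dspace (F n) s) (L n) < e / 3"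
          by (rule tendstoD[OF L]) (use e in simp)
        then show "\<forall>\<^sub>F s in ?A. dist (g s) l < e"
        proof (rule eventually_mono)
          fix s assume "dist (apply_dspace (F n) s) (L n) < e / 3"
          then show "dist (g s) l < e" using n(1)[of s] n(2) unfolding dist_real_def by linarith
        qed
      qed
      then show ?thesis by blast
    qed simp
  qed
  ultimately have G: "apply_dspace (Dspace g) = g" by (simp add: Dspace_inverse)
  have "F \<longlonglongrightarrow> Dspace g"
  proof (rule tendstoI)
    fix e :: real assume e: "e > 0"
    have "\<forall>\<^sub>F n in sequentially. \<forall>s\<in>UNIV. dist (apply_dspace (F n) s) (g s) < e / 2"
      using uniform_limitD[OF g, of "e / 2"] e by simp
    then show "\<forall>\<^sub>F n in sequentially. dist (F n) (Dspace g) < e"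
    proof (rule eventually_mono)
      fix n assume n: "\<forall>s\<in>UNIV. dist (apply_dspace (F n) s) (g s) < e / 2"
      have "norm (F n - Dspace g) \<le> e / 2"
        by (rule norm_dspace_le) (use n G in \<open>auto simp: dist_real_def less_imp_le\<close>)
      then show "dist (F n) (Dspace g) < e" using e by (simp add: dist_norm)
    qed
  qed
  then show "convergent F" by (rule convergentI)
qed

text \<open>This is in general smaller than the Borel \<open>\<sigma>\<close>-field of the norm topology.\<close>

definition evaluation_algebra :: "('m::finite) dspace measure" where
  "evaluation_algebra =
     sigma UNIV {{f. apply_dspace f t \<in> B} | t B. t \<in> cbox 0 1 \<and> B \<in> sets borel}"


section \<open>Bounded multilinear maps\<close>

text \<open>The tuples in \<open>X\<^sup>l\<close> are the functions from a finite type of cardinality \<open>l\<close> to \<open>X\<close>.\<close>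

definition bounded_multilinear ::
    "(('l::finite \<Rightarrow> 'a::real_normed_vector) \<Rightarrow> 'b::real_normed_vector) \<Rightarrow> bool" where
  "bounded_multilinear \<Upsilon> \<longleftrightarrow>
     (\<forall>i x. linear (\<lambda>y. \<Upsilon> (x(i := y)))) \<and>
     (\<exists>C. \<forall>x. norm (\<Upsilon> x) \<le> C * (\<Prod>i\<in>UNIV. norm (x i)))"

end

theory Submission
  imports Defs
begin

text \<open>
  The idea is to remove, coordinate by coordinate, the dependence of the form on all but
  countably many evaluations. Fix an argument \<open>j\<close> and a coordinate \<open>i\<close>, and let \<open>P\<^sub>n\<close> replace
  \<open>t\<^sub>i\<close> by the next dyadic point of level \<open>n\<close> to its right. Since functionals have bounded variation
  along indicators of half-lines, \<open>\<Lambda> = lim \<Upsilon> \<circ> P\<^sub>n\<close> exists; every \<open>\<Upsilon> \<circ> P\<^sub>n\<close> is a finite sum of forms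
  that see the \<open>j\<close>-th argument only on a slice \<open>t\<^sub>i = c\<close>, while \<open>\<Upsilon> - \<Lambda>\<close> vanishes when the \<open>j\<close>-th
  argument is continuous in \<open>t\<^sub>i\<close>, so that it only sees jumps. After all coordinates have been treated,
  every pair \<open>(j, i)\<close> is of one of these two types. The coefficients of such a form on products of
  indicators of half-lines are square summable over the jump coordinates: subtracting steep ramps, which
  the form does not see, makes the indicators disjointly supported, and the signs of a
  combination can be chosen so that its square dominates the sum of squares. Hence only countably
  many jump locations matter, and jumps there are limits of differences of evaluations.
\<close>

section \<open>Operations on \<open>D([0,1]\<^sup>m)\<close> in one coordinate\<close>

text \<open>In the sup norm the space is not separable, and the evaluations generate in general
  fewer sets than the open sets do, so norm continuity alone gives no measurability. What preserves
  measurability is a pointwise limit of a sequence of forms, but a bounded form need not respect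
  pointwise convergence of its arguments. This is why \<Lambda> can differ from \<Upsilon> although
  P_n f tends to f at every point of the cube, by right-continuity. Squares appear because the
  coefficients of a bounded bilinear form need not be absolutely summable (already on c_0 x c_0),
  while their squares yield to an elementary choice of signs; any summable positive power gives
  countability. The coordinates can be treated separately because operators in different coordinates
  commute: treating a pair (j, i) leaves the types of all other pairs intact. Two inductions result,
  one on the number of pairs of neither type, one on the number of pairs not yet frozen on a slice.
  When every pair is frozen, the form is a multiple of a product of point evaluations.\<close>

definition upd :: "real ^ 'm \<Rightarrow> 'm \<Rightarrow> real \<Rightarrow> real ^ 'm" where
  "upd t i c = (\<chi> k. if k = i then c else t $ k)"

lemma upd_nth [simp]: "upd t i c $ k = (if k = i then c else t $ k)"
  by (simp add: upd_def)

lemma upd_upd [simp]: "upd (upd t i c) i d = upd t i d"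
  by (simp add: vec_eq_iff)

lemma upd_commute: "i \<noteq> k \<Longrightarrow> upd (upd t i c) k d = upd (upd t k d) i c"
  by (simp add: vec_eq_iff)

lemma upd_mem_cube: "t \<in> cbox 0 1 \<Longrightarrow> c \<in> {0..1} \<Longrightarrow> upd t i c \<in> cbox 0 1"
  by (auto simp: mem_box_cart)

lemma nth_mem_cube: "t \<in> cbox 0 (1 :: real ^ 'm) \<Longrightarrow> t $ i \<in> {0..1}"
  by (auto simp: mem_box_cart)

text \<open>Stronger than the usual notion of this name: \<open>x\<close> belongs to
  \<open>{x..1}\<close>, so the first limit forces right-continuity on [0,1]. At
  \<open>x = 0\<close> the second filter is trivial. This is the case m = 1 of
  \<open>has_quadrant_limits\<close>, for functions of a real variable.\<close>

definition regulated :: "(real \<Rightarrow> real) \<Rightarrow> bool" where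
  "regulated h \<longleftrightarrow> (\<forall>x\<in>{0..1}.
     (\<exists>L. (h \<longlongrightarrow> L) (inf (nhds x) (principal {x..1}))) \<and>
     (\<exists>L. (h \<longlongrightarrow> L) (inf (nhds x) (principal {0..<x}))))"

lemma regulated_add: "regulated g \<Longrightarrow> regulated h \<Longrightarrow> regulated (\<lambda>x. g x + h x)"
  unfolding regulated_def by (blast intro: tendsto_add)

lemma regulated_cmult: "regulated h \<Longrightarrow> regulated (\<lambda>x. c * h x)"
  unfolding regulated_def by (blast intro: tendsto_mult_left)

lemma regulated_diff: "regulated g \<Longrightarrow> regulated h \<Longrightarrow> regulated (\<lambda>x. g x - h x)"
  unfolding regulated_def by (blast intro: tendsto_diff)

lemma regulated_const: "regulated (\<lambda>x. c)"
  unfolding regulated_def by (blast intro: tendsto_const)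

lemma regulated_sum: "(\<And>a. a \<in> A \<Longrightarrow> regulated (h a)) \<Longrightarrow> regulated (\<lambda>x. \<Sum>a\<in>A. h a x)"
  by (induction A rule: infinite_finite_induct) (auto intro: regulated_add regulated_const)

lemma regulated_continuous: 
  assumes "continuous_on UNIV h" shows "regulated h"
proof -
  have "(h \<longlongrightarrow> h x) (inf (nhds x) (principal S))" for x S
  proof (rule filterlim_mono[OF _ order.refl inf_le1])
    show "(h \<longlongrightarrow> h x) (nhds x)"
      using assms by (simp add: continuous_on_eq_continuous_at continuous_at isCont_def tendsto_at_iff_tendsto_nhds)
  qed
  then show ?thesis unfolding regulated_def by blast
qed

definition heav :: "real \<Rightarrow> real \<Rightarrow> real" where
  "heav s x = (if s \<le> x then 1 else 0)"

lemma regulated_heav: "regulated (heav s)"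
  unfolding regulated_def
proof (intro ballI conjI)
  fix x :: real
  have "(heav s \<longlongrightarrow> heav s x) (inf (nhds x) (principal {x..1}))"
  proof (cases "s \<le> x")
    case True
    then show ?thesis
      by (intro tendsto_eventually) (auto simp: eventually_inf_principal heav_def)
  next
    case False
    then have "\<forall>\<^sub>F y in nhds x. y < s" by (intro eventually_nhds_in_open[of "{..<s}", simplified]) auto
    then show ?thesis using False
      by (intro tendsto_eventually) (auto simp: eventually_inf_principal heav_def elim: eventually_mono)
  qed
  then show "\<exists>L. (heav s \<longlongrightarrow> L) (inf (nhds x) (principal {x..1}))" by blast
  have "(heav s \<longlongrightarrow> (if s < x then 1 else 0)) (inf (nhds x) (principal {0..<x}))"
  proof (cases "s < x")
    case True
    then have "\<forall>\<^sub>F y in nhds x. s < y" by (intro eventually_nhds_in_open[of "{s<..}", simplified]) auto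
    then show ?thesis using True
      by (intro tendsto_eventually) (auto simp: eventually_inf_principal heav_def elim: eventually_mono)
  next
    case False
    then show ?thesis
      by (intro tendsto_eventually) (auto simp: eventually_inf_principal heav_def)
  qed
  then show "\<exists>L. (heav s \<longlongrightarrow> L) (inf (nhds x) (principal {0..<x}))" by blast
qed

lemma has_quadrant_limits_mult:
  fixes f g :: "real ^ 'm \<Rightarrow> real"
  assumes "has_quadrant_limits f" "has_quadrant_limits g"
  shows "has_quadrant_limits (\<lambda>t. f t * g t)"
  using assms unfolding has_quadrant_limits_def by (blast intro: tendsto_mult)

lemma has_quadrant_limits_const: "has_quadrant_limits (\<lambda>t. c)"
  unfolding has_quadrant_limits_def by (blast intro: tendsto_const)

lemma has_quadrant_limits_prod:
  fixes f :: "'a \<Rightarrow> real ^ 'm \<Rightarrow> real"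
  shows "(\<And>a. a \<in> A \<Longrightarrow> has_quadrant_limits (f a)) \<Longrightarrow> has_quadrant_limits (\<lambda>t. \<Prod>a\<in>A. f a t)"
  by (induction A rule: infinite_finite_induct)
    (auto intro: has_quadrant_limits_mult has_quadrant_limits_const)

lemma has_quadrant_limits_cong:
  assumes "\<And>t. t \<in> cbox 0 1 \<Longrightarrow> f t = g t"
  shows "has_quadrant_limits f \<longleftrightarrow> has_quadrant_limits g"
proof -
  have "(f \<longlongrightarrow> L) (inf (nhds t) (principal S)) \<longleftrightarrow> (g \<longlongrightarrow> L) (inf (nhds t) (principal S))"
    if "t \<in> cbox 0 1" "S \<in> quadrants t" for t S L
    using quadrants_subset[OF that] assms
    by (intro filterlim_cong refl) (auto simp: eventually_inf_principal subset_iff)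
  then show ?thesis unfolding has_quadrant_limits_def by auto
qed

lemma has_quadrant_limits_nth:
  assumes "regulated h"
  shows "has_quadrant_limits (\<lambda>t :: real ^ 'm. h (t $ i))"
  unfolding has_quadrant_limits_def
proof (intro ballI)
  fix t :: "real ^ 'm" and S assume t: "t \<in> cbox 0 1" and S: "S \<in> quadrants t"
  then obtain J where J: "S = {s. \<forall>i. s $ i \<in> J i}"
    "\<And>i. J i = {t $ i..1} \<or> (0 < t $ i \<and> J i = {0..<t $ i})"
    by (auto simp: quadrants_def)
  obtain L where L: "(h \<longlongrightarrow> L) (inf (nhds (t $ i)) (principal (J i)))"
    using assms J(2)[of i] nth_mem_cube[OF t, of i] unfolding regulated_def by metis
  have "filterlim (\<lambda>s. s $ i) (inf (nhds (t $ i)) (principal (J i))) (inf (nhds t) (principal S))"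
    unfolding filterlim_inf filterlim_principal
  proof
    show "((\<lambda>s. s $ i) \<longlongrightarrow> t $ i) (inf (nhds t) (principal S))"
      by (rule filterlim_mono[OF _ order.refl inf_le1]) (intro tendsto_vec_nth filterlim_ident)
    show "\<forall>\<^sub>F s in inf (nhds t) (principal S). s $ i \<in> J i"
      by (auto simp: eventually_inf_principal J(1))
  qed
  from filterlim_compose[OF L this] show "\<exists>L. ((\<lambda>t. h (t $ i)) \<longlongrightarrow> L) (inf (nhds t) (principal S))"
    by blast
qed

lemma has_quadrant_limits_upd:
  fixes f :: "real ^ 'm \<Rightarrow> real"
  assumes f: "has_quadrant_limits f" and c: "c \<in> {0..1}"
  shows "has_quadrant_limits (\<lambda>t. f (upd t i c))"
  unfolding has_quadrant_limits_def
proof (intro ballI)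
  fix t :: "real ^ 'm" and S assume t: "t \<in> cbox 0 1" and S: "S \<in> quadrants t"
  then obtain J where J: "S = {s. \<forall>i. s $ i \<in> J i}"
    "\<And>i. J i = {t $ i..1} \<or> (0 < t $ i \<and> J i = {0..<t $ i})"
    by (auto simp: quadrants_def)
  define S' where "S' = {s. \<forall>k. s $ k \<in> (J(i := {c..1})) k}"
  have "S' \<in> quadrants (upd t i c)"
    unfolding S'_def quadrants_def using J(2) by (force intro!: exI[of _ "J(i := {c..1})"])
  then obtain L where L: "(f \<longlongrightarrow> L) (inf (nhds (upd t i c)) (principal S'))"
    using f upd_mem_cube[OF t c] unfolding has_quadrant_limits_def by blast
  have "filterlim (\<lambda>s. upd s i c) (inf (nhds (upd t i c)) (principal S')) (inf (nhds t) (principal S))"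
    unfolding filterlim_inf filterlim_principal
  proof
    have "((\<lambda>s. upd s i c) \<longlongrightarrow> upd t i c) (nhds t)"
      unfolding upd_def by (intro tendsto_intros tendsto_vec_lambda) (auto intro!: tendsto_vec_nth filterlim_ident)
    then show "((\<lambda>s. upd s i c) \<longlongrightarrow> upd t i c) (inf (nhds t) (principal S))"
      by (rule filterlim_mono[OF _ order.refl inf_le1])
    show "\<forall>\<^sub>F s in inf (nhds t) (principal S). upd s i c \<in> S'"
      using c by (auto simp: eventually_inf_principal J(1) S'_def)
  qed
  from filterlim_compose[OF L this] show "\<exists>L. ((\<lambda>t. f (upd t i c)) \<longlongrightarrow> L) (inf (nhds t) (principal S))"
    by blast
qed

lemma apply_dspace_outside [simp]: "t \<notin> cbox 0 1 \<Longrightarrow> apply_dspace f t = 0"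
  using apply_dspace[of f] by auto

lemma has_quadrant_limits_apply_dspace: "has_quadrant_limits (apply_dspace f)"
  using apply_dspace[of f] by auto

lemma apply_dspace_sum [simp]: "apply_dspace (\<Sum>a\<in>A. f a) t = (\<Sum>a\<in>A. apply_dspace (f a) t)"
  by (induction A rule: infinite_finite_induct) auto

definition mult_coord :: "'m \<Rightarrow> (real \<Rightarrow> real) \<Rightarrow> ('m::finite) dspace \<Rightarrow> 'm dspace" where
  "mult_coord i h f = Dspace (\<lambda>t. h (t $ i) * apply_dspace f t)"

lemma apply_mult [simp]: "regulated h \<Longrightarrow> apply_dspace (mult_coord i h f) t = h (t $ i) * apply_dspace f t"
  unfolding mult_coord_def
  by (subst Dspace_inverse)
    (auto intro!: has_quadrant_limits_mult has_quadrant_limits_nth has_quadrant_limits_apply_dspace)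

text \<open>The guard keeps the value 0 outside the cube: \<open>upd\<close> can move an outside
  point into it.\<close>

definition slice :: "'m \<Rightarrow> real \<Rightarrow> ('m::finite) dspace \<Rightarrow> 'm dspace" where
  "slice i c f = Dspace (\<lambda>t. if t \<in> cbox 0 1 then apply_dspace f (upd t i c) else 0)"

lemma apply_slice [simp]:
  assumes "c \<in> {0..1}"
  shows "apply_dspace (slice i c f) t = (if t \<in> cbox 0 1 then apply_dspace f (upd t i c) else 0)"
proof -
  have "has_quadrant_limits (\<lambda>t. if t \<in> cbox 0 1 then apply_dspace f (upd t i c) else 0)"
    by (subst has_quadrant_limits_cong[where g = "\<lambda>t. apply_dspace f (upd t i c)"])
      (auto intro!: has_quadrant_limits_upd has_quadrant_limits_apply_dspace assms)
  then show ?thesis unfolding slice_def by (subst Dspace_inverse) auto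
qed

definition tens :: "('m \<Rightarrow> real \<Rightarrow> real) \<Rightarrow> ('m::finite) dspace" where
  "tens h = Dspace (\<lambda>t. if t \<in> cbox 0 1 then \<Prod>i\<in>UNIV. h i (t $ i) else 0)"

lemma apply_tens [simp]:
  assumes "\<And>i. regulated (h i)"
  shows "apply_dspace (tens h) t = (if t \<in> cbox 0 1 then \<Prod>i\<in>UNIV. h i (t $ i) else 0)"
proof -
  have "has_quadrant_limits (\<lambda>t. if t \<in> cbox 0 1 then \<Prod>i\<in>UNIV. h i (t $ i) else 0)"
    by (subst has_quadrant_limits_cong[where g = "\<lambda>t. \<Prod>i\<in>UNIV. h i (t $ i)"])
      (auto intro!: has_quadrant_limits_prod has_quadrant_limits_nth assms)
  then show ?thesis unfolding tens_def by (subst Dspace_inverse) auto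
qed

text \<open>The analogue in m coordinates of the fact that right-continuous functions with left
  limits are uniform limits of step functions. Near each point \<open>f\<close> is almost constant
  on every quadrant; compactness leaves finitely many such points, and their data form one grid
  \<open>S\<close> that serves all coordinates.\<close>

lemma regulated_approx:
  fixes f :: "('m::finite) dspace"
  assumes "e > 0"
  obtains S where "finite S" "0 \<in> S" "S \<subseteq> {0..1}"
    "\<And>t t'. t \<in> cbox 0 1 \<Longrightarrow> t' \<in> cbox 0 1 \<Longrightarrow> (\<And>i s. s \<in> S \<Longrightarrow> s \<le> t $ i \<longleftrightarrow> s \<le> t' $ i) \<Longrightarrow>
      \<bar>apply_dspace f t - apply_dspace f t'\<bar> \<le> e"
proof -
  \<comment> \<open>Small oscillation is asked on the closed box, since the grid will only give the
    weak inequality \<open>a u $ i \<le> t' $ i\<close> for the second point.\<close>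
  define osc where "osc u D \<longleftrightarrow> (\<forall>S\<in>quadrants u. \<forall>t\<in>S \<inter> D. \<forall>t'\<in>S \<inter> D.
      \<bar>apply_dspace f t - apply_dspace f t'\<bar> \<le> e)" for u D
  have loc: "\<exists>a b. u \<in> box a b \<and> osc u (cbox a b)" if u: "u \<in> cbox 0 1" for u :: "real ^ 'm"
  proof -
    have "\<exists>L. \<forall>\<^sub>F s in nhds u. s \<in> S \<longrightarrow> \<bar>apply_dspace f s - L\<bar> < e / 2" if S: "S \<in> quadrants u" for S
    proof -
      obtain L where "(apply_dspace f \<longlongrightarrow> L) (inf (nhds u) (principal S))"
        using has_quadrant_limits_apply_dspace[of f] u S unfolding has_quadrant_limits_def by blast
      from tendstoD[OF this, of "e / 2"] assms show ?thesis
        by (auto simp: eventually_inf_principal dist_real_def)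
    qed
    then have "\<forall>S\<in>quadrants u. \<exists>L. \<forall>\<^sub>F s in nhds u. s \<in> S \<longrightarrow> \<bar>apply_dspace f s - L\<bar> < e / 2"
      by blast
    from bchoice[OF this] obtain L where
      L: "\<And>S. S \<in> quadrants u \<Longrightarrow> \<forall>\<^sub>F s in nhds u. s \<in> S \<longrightarrow> \<bar>apply_dspace f s - L S\<bar> < e / 2"
      by blast
    then have "\<forall>\<^sub>F s in nhds u. \<forall>S\<in>quadrants u. s \<in> S \<longrightarrow> \<bar>apply_dspace f s - L S\<bar> < e / 2"
      by (intro eventually_ball_finite finite_quadrants) auto
    then obtain U where U: "open U" "u \<in> U"
      "\<And>s S. s \<in> U \<Longrightarrow> S \<in> quadrants u \<Longrightarrow> s \<in> S \<Longrightarrow> \<bar>apply_dspace f s - L S\<bar> < e / 2"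
      unfolding eventually_nhds by blast
    obtain a b where ab: "u \<in> box a b" "cbox a b \<subseteq> U"
      using open_contains_cbox[OF U(1,2)] by metis
    have "\<bar>apply_dspace f t - apply_dspace f t'\<bar> \<le> e"
      if "S \<in> quadrants u" "t \<in> S \<inter> cbox a b" "t' \<in> S \<inter> cbox a b" for S t t'
      using U(3)[of t S] U(3)[of t' S] that ab(2) by (auto simp: subset_iff abs_if split: if_splits)
    then have "osc u (cbox a b)" unfolding osc_def by blast
    then show ?thesis using ab(1) by blast
  qed
  then obtain a b where ab: "\<And>u. u \<in> cbox 0 1 \<Longrightarrow> u \<in> box (a u) (b u)"
    "\<And>u. u \<in> cbox 0 1 \<Longrightarrow> osc u (cbox (a u) (b u))"
    by metis
  have "cbox 0 1 \<subseteq> (\<Union>u\<in>cbox 0 1. box (a u) (b u))" using ab(1) by blast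
  then obtain C where C: "C \<subseteq> cbox 0 (1 :: real ^ 'm)" "finite C" "cbox 0 (1 :: real ^ 'm) \<subseteq> (\<Union>u\<in>C. box (a u) (b u))"
    by (rule compactE_image[OF compact_cbox open_box])
  \<comment> \<open>The end points \<open>a u\<close>, \<open>b u\<close> keep \<open>t'\<close> in
    the box of \<open>t\<close>; the centre \<open>u\<close> keeps it in the same quadrant. Grid
    values outside [0,1] separate no points of the cube and are dropped.\<close>
  define S0 where "S0 = (\<Union>u\<in>C. \<Union>i. {a u $ i, b u $ i, u $ i})"
  define S where "S = insert 0 (S0 \<inter> {0..1})"
  have "finite S0" unfolding S0_def by (intro finite_UN_I C(2)) auto
  show ?thesis
  proof
    show "finite S" "0 \<in> S" "S \<subseteq> {0..1}" using \<open>finite S0\<close> by (auto simp: S_def)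
    fix t t' :: "real ^ 'm"
    assume t: "t \<in> cbox 0 1" "t' \<in> cbox 0 1" and same: "\<And>i s. s \<in> S \<Longrightarrow> s \<le> t $ i \<longleftrightarrow> s \<le> t' $ i"
    have same0: "s \<le> t $ i \<longleftrightarrow> s \<le> t' $ i" if "s \<in> S0" for s i
      using same[of s i] nth_mem_cube[OF t(1), of i] nth_mem_cube[OF t(2), of i] that
      by (cases "s \<in> {0..1}") (auto simp: S_def)
    obtain u where u: "u \<in> C" "t \<in> box (a u) (b u)" using C(3) t(1) by auto
    have inS0: "a u $ i \<in> S0" "b u $ i \<in> S0" "u $ i \<in> S0" for i
      using u(1) by (auto simp: S0_def)
    have box: "a u $ i < t $ i" "t $ i < b u $ i" for i using u(2) by (auto simp: mem_box_cart)
    have "a u $ i \<le> t' $ i" "t' $ i < b u $ i" for i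
      using same0[OF inS0(1), of i i] same0[OF inS0(2), of i i] box[of i] by auto
    then have t': "t' \<in> cbox (a u) (b u)" by (auto simp: mem_box_cart less_imp_le)
    obtain Q where Q: "Q \<in> quadrants u" "t \<in> Q" using quadrants_cover[OF t(1)] by blast
    then obtain J where J: "Q = {s. \<forall>i. s $ i \<in> J i}"
      "\<And>i. J i = {u $ i..1} \<or> (0 < u $ i \<and> J i = {0..<u $ i})"
      by (auto simp: quadrants_def)
    have "t' $ i \<in> J i" for i
    proof -
      have "t $ i \<in> J i" using Q(2) J(1) by blast
      moreover have "u $ i \<le> t $ i \<longleftrightarrow> u $ i \<le> t' $ i" by (rule same0[OF inS0(3)])
      moreover have "t' $ i \<in> {0..1}" by (rule nth_mem_cube[OF t(2)])
      ultimately show ?thesis using J(2)[of i] by (elim disjE conjE) simp_all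
    qed
    then have "t' \<in> Q" using J(1) by blast
    then show "\<bar>apply_dspace f t - apply_dspace f t'\<bar> \<le> e"
      using ab(2)[of u] Q u C(1) t' box_subset_cbox[of "a u" "b u"] unfolding osc_def by blast
  qed
qed

section \<open>Approximation in one coordinate\<close>

lemma apply_dspace_bounded_linear:
  fixes T :: "('m::finite) dspace \<Rightarrow> 'm dspace"
  assumes "\<And>f g t. t \<in> cbox 0 1 \<Longrightarrow> apply_dspace (T (f + g)) t = apply_dspace (T f) t + apply_dspace (T g) t"
    and "\<And>c f t. t \<in> cbox 0 1 \<Longrightarrow> apply_dspace (T (c *\<^sub>R f)) t = c * apply_dspace (T f) t"
    and "\<And>f t. t \<in> cbox 0 1 \<Longrightarrow> \<bar>apply_dspace (T f) t\<bar> \<le> norm f * B"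
  shows "bounded_linear T"
  by (rule bounded_linear_intro[of _ B]) (auto intro!: dspace_eqI norm_dspace_le assms simp: assms)

lemma bounded_linear_mult:
  assumes "regulated h" "\<And>x. x \<in> {0..1} \<Longrightarrow> \<bar>h x\<bar> \<le> B"
  shows "bounded_linear (mult_coord i h)"
proof (rule apply_dspace_bounded_linear)
  fix f and t :: "real ^ 'a" assume t: "t \<in> cbox 0 1"
  have "\<bar>apply_dspace f t\<bar> * \<bar>h (t $ i)\<bar> \<le> norm f * B"
    by (intro mult_mono norm_dspace_ge assms nth_mem_cube[OF t]) auto
  then show "\<bar>apply_dspace (mult_coord i h f) t\<bar> \<le> norm f * B"
    by (simp add: assms abs_mult mult.commute)
qed (simp_all add: assms algebra_simps)

lemma heav_bounds: "0 \<le> heav s x" "heav s x \<le> 1" "\<bar>heav s x\<bar> \<le> 1"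
  by (auto simp: heav_def)

lemma apply_heav [simp]: "apply_dspace (mult_coord i (heav s) f) t = heav s (t $ i) * apply_dspace f t"
  by (simp add: regulated_heav)

lemma bounded_linear_heav: "bounded_linear (mult_coord i (heav s))"
  by (rule bounded_linear_mult[of _ 1]) (simp_all add: regulated_heav heav_bounds)

lemma bounded_linear_slice:
  assumes "c \<in> {0..1}"
  shows "bounded_linear (slice i c)"
  by (rule apply_dspace_bounded_linear[of _ 1]) (use assms norm_dspace_ge in auto)

lemma slice_slice [simp]:
  "c \<in> {0..1} \<Longrightarrow> d \<in> {0..1} \<Longrightarrow> slice i c (slice i d f) = slice i d f"
  by (rule dspace_eqI) (simp add: upd_mem_cube)

lemma norm_slice_le: "c \<in> {0..1} \<Longrightarrow> norm (slice i c f) \<le> norm f"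
  by (rule norm_dspace_le) (simp add: norm_dspace_ge)

lemma slice_heav:
  "c \<in> {0..1} \<Longrightarrow> slice i c (mult_coord i (heav s) f) = heav s c *\<^sub>R slice i c f"
  by (rule dspace_eqI) (simp add: upd_mem_cube)

text \<open>Captures that \<open>T\<close> acts in coordinate \<open>i\<close> alone. Commuting with
  slices and with half-line indicators in the other coordinates is enough, because the step
  operators are sums and differences of compositions of these.\<close>

definition coord_op :: "'m \<Rightarrow> (('m::finite) dspace \<Rightarrow> 'm dspace) \<Rightarrow> bool" where
  "coord_op i T \<longleftrightarrow> bounded_linear T \<and>
     (\<forall>k f. k \<noteq> i \<longrightarrow> (\<forall>c\<in>{0..1}. T (slice k c f) = slice k c (T f)) \<and>
       (\<forall>s. T (mult_coord k (heav s) f) = mult_coord k (heav s) (T f)))"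

lemma coord_op_bounded_linear: "coord_op i T \<Longrightarrow> bounded_linear T"
  by (simp add: coord_op_def)

lemma coord_op_slice_commute:
  assumes "coord_op i T" "i \<noteq> k" "c \<in> {0..1}"
  shows "T (slice k c f) = slice k c (T f)"
  using assms(1)[unfolded coord_op_def, THEN conjunct2, rule_format, of k f] assms(2,3) by blast

lemma coord_op_heav_commute:
  assumes "coord_op i T" "i \<noteq> k"
  shows "T (mult_coord k (heav s) f) = mult_coord k (heav s) (T f)"
  using assms(1)[unfolded coord_op_def, THEN conjunct2, rule_format, of k f] assms(2) by blast

lemma coord_op_slice: "c \<in> {0..1} \<Longrightarrow> coord_op i (slice i c)"
  unfolding coord_op_def
  by (auto intro!: bounded_linear_slice dspace_eqI simp: upd_mem_cube upd_commute[of i])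

lemma coord_op_heav: "coord_op i (mult_coord i (heav s))"
  unfolding coord_op_def
  by (auto intro!: bounded_linear_heav dspace_eqI simp: upd_mem_cube)

lemma coord_op_comp: "coord_op i S \<Longrightarrow> coord_op i T \<Longrightarrow> coord_op i (\<lambda>f. S (T f))"
  unfolding coord_op_def by (auto intro: bounded_linear_compose)

lemma coord_op_diff: "coord_op i S \<Longrightarrow> coord_op i T \<Longrightarrow> coord_op i (\<lambda>f. S f - T f)"
  unfolding coord_op_def
  by (auto intro: bounded_linear_sub
      simp: linear_diff bounded_linear.linear bounded_linear_slice bounded_linear_heav)

lemma coord_op_sum: "(\<And>a. a \<in> A \<Longrightarrow> coord_op i (T a)) \<Longrightarrow> coord_op i (\<lambda>f. \<Sum>a\<in>A. T a f)"
  unfolding coord_op_def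
  by (auto intro: bounded_linear_sum
      simp: linear_sum bounded_linear.linear bounded_linear_slice bounded_linear_heav)

section \<open>Grids in [0,1] and the step operators they define\<close>

definition rfloor :: "real set \<Rightarrow> real \<Rightarrow> real" where
  "rfloor S x = Max {s \<in> S. s \<le> x}"

text \<open>The strict inequality makes this constant on the cells [s, s') between neighbouring grid
  points, so that freezing \<open>t_i\<close> at it yields functions that are again
  right-continuous. The default 1 keeps the value in [0,1].\<close>

definition unext :: "real set \<Rightarrow> real \<Rightarrow> real" where
  "unext S x = Min (insert 1 {s \<in> S. x < s})"

text \<open>The value \<open>2\<close> lies outside of \<open>[0,1]\<close>, so that \<open>heav 2\<close> vanishes there.\<close>

definition nxt :: "real set \<Rightarrow> real \<Rightarrow> real" where
  "nxt S x = Min (insert 2 {s \<in> S. x < s})"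

lemma rfloor:
  assumes "finite S" "0 \<in> S" "0 \<le> x"
  shows "rfloor S x \<in> S" "rfloor S x \<le> x" "\<And>s. s \<in> S \<Longrightarrow> s \<le> x \<longleftrightarrow> s \<le> rfloor S x"
proof -
  have "rfloor S x \<in> {s \<in> S. s \<le> x}"
    unfolding rfloor_def by (rule Max_in) (use assms in auto)
  then show 1: "rfloor S x \<in> S" "rfloor S x \<le> x" by auto
  show "s \<le> x \<longleftrightarrow> s \<le> rfloor S x" if "s \<in> S" for s
    using 1 that assms(1) by (auto simp: rfloor_def intro: Max_ge)
qed

lemma heav_cell:
  assumes "finite S" "0 \<in> S" "x \<in> {0..1}" "s \<in> S"
  shows "heav s x - heav (nxt S s) x = (if s = rfloor S x then 1 else 0)"
proof -
  have x: "0 \<le> x" "x \<le> 1" using assms(3) by auto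
  note r = rfloor[OF assms(1,2) x(1)]
  have "nxt S s \<le> x \<longleftrightarrow> (\<exists>s'\<in>S. s < s' \<and> s' \<le> x)"
    unfolding nxt_def using assms(1) x by (subst Min_le_iff) auto
  also have "\<dots> \<longleftrightarrow> s < rfloor S x" using r by (meson le_less_trans less_le_trans)
  finally show ?thesis using r(3)[OF assms(4)] by (auto simp: heav_def)
qed

text \<open>On the cell that starts at \<open>s\<close>, the coordinate \<open>t_i\<close> is frozen
  at \<open>v s\<close>. The indicator of the cell is written as a difference of two half-lines, so
  that each term is a half-line times a slice, the shape for which everything else is
  proved.\<close>

definition step :: "'m \<Rightarrow> real set \<Rightarrow> (real \<Rightarrow> real) \<Rightarrow> ('m::finite) dspace \<Rightarrow> 'm dspace" where
  "step i S v f = (\<Sum>s\<in>S. mult_coord i (heav s) (slice i (v s) f) - mult_coord i (heav (nxt S s)) (slice i (v s) f))"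

lemma apply_step:
  assumes "finite S" "0 \<in> S" "v ` S \<subseteq> {0..1}" "t \<in> cbox 0 1"
  shows "apply_dspace (step i S v f) t = apply_dspace f (upd t i (v (rfloor S (t $ i))))"
proof -
  have t: "t $ i \<in> {0..1}" by (rule nth_mem_cube[OF assms(4)])
  have "apply_dspace (step i S v f) t =
      (\<Sum>s\<in>S. (heav s (t $ i) - heav (nxt S s) (t $ i)) * apply_dspace f (upd t i (v s)))"
    unfolding step_def apply_dspace_sum
  proof (intro sum.cong refl)
    fix s assume "s \<in> S"
    then have "v s \<in> {0..1}" using assms(3) by blast
    then show "apply_dspace (mult_coord i (heav s) (slice i (v s) f) - mult_coord i (heav (nxt S s)) (slice i (v s) f)) t =
        (heav s (t $ i) - heav (nxt S s) (t $ i)) * apply_dspace f (upd t i (v s))"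
      using assms(4) by (simp add: algebra_simps)
  qed
  also have "\<dots> = (\<Sum>s\<in>S. if s = rfloor S (t $ i) then apply_dspace f (upd t i (v s)) else 0)"
    by (intro sum.cong refl) (simp add: heav_cell[OF assms(1,2) t])
  also have "\<dots> = apply_dspace f (upd t i (v (rfloor S (t $ i))))"
    using assms(1) rfloor(1)[OF assms(1,2)] t by (simp add: sum.delta)
  finally show ?thesis .
qed

lemma coord_op_step:
  assumes "v ` S \<subseteq> {0..1}"
  shows "coord_op i (step i S v)"
  unfolding step_def[abs_def]
proof (rule coord_op_sum)
  fix s assume "s \<in> S"
  then have "v s \<in> {0..1}" using assms by blast
  then have "coord_op i (\<lambda>f. mult_coord i (heav s') (slice i (v s) f))" for s'
    by (intro coord_op_comp[OF coord_op_heav coord_op_slice])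
  then show "coord_op i (\<lambda>f. mult_coord i (heav s) (slice i (v s) f) - mult_coord i (heav (nxt S s)) (slice i (v s) f))"
    by (rule coord_op_diff) fact
qed

text \<open>The step operator with \<open>v\<close> the identity moves \<open>t_i\<close> to the
  left end of its cell, which changes \<open>f\<close> by at most its oscillation there, so step
  functions approximate \<open>f\<close> in norm. Used as an induction principle: a closed linear
  property of \<open>f\<close> needs checking only for half-line indicators in \<open>t_i\<close>
  times functions free of \<open>t_i\<close>.\<close>

lemma closed_subspace_coord:
  fixes f :: "('m::finite) dspace"
  assumes W: "subspace W" "closed W"
    and gen: "\<And>s c. c \<in> {0..1} \<Longrightarrow> mult_coord i (heav s) (slice i c f) \<in> W"
  shows "f \<in> W"
proof -
  have "\<exists>g\<in>W. dist g f < e" if "e > 0" for e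
  proof -
    from that have "e / 2 > 0" by simp
    then obtain S where S: "finite S" "0 \<in> S" "S \<subseteq> {0..1}"
      "\<And>t t'. t \<in> cbox 0 1 \<Longrightarrow> t' \<in> cbox 0 1 \<Longrightarrow> (\<And>i s. s \<in> S \<Longrightarrow> s \<le> t $ i \<longleftrightarrow> s \<le> t' $ i) \<Longrightarrow>
        \<bar>apply_dspace f t - apply_dspace f t'\<bar> \<le> e / 2"
      by (rule regulated_approx[of "e / 2" f]) blast
    have "step i S (\<lambda>s. s) f \<in> W"
      unfolding step_def using S(3)
      by (intro subspace_sum[OF W(1)] subspace_diff[OF W(1)] gen) auto
    moreover have "norm (step i S (\<lambda>s. s) f - f) \<le> e / 2"
    proof (rule norm_dspace_le)
      fix t :: "real ^ 'm" assume t: "t \<in> cbox 0 1"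
      have "0 \<le> t $ i" using nth_mem_cube[OF t, of i] by simp
      note r = rfloor[OF S(1,2) this]
      have "upd t i (rfloor S (t $ i)) \<in> cbox 0 1"
        using r(1) S(3) by (intro upd_mem_cube t) auto
      then have "\<bar>apply_dspace f (upd t i (rfloor S (t $ i))) - apply_dspace f t\<bar> \<le> e / 2"
        by (rule S(4)[OF _ t]) (use r(3) in auto)
      then show "\<bar>apply_dspace (step i S (\<lambda>s. s) f - f) t\<bar> \<le> e / 2"
        using S(3) t by (simp add: apply_step[OF S(1,2)])
    qed
    ultimately show ?thesis using that by (intro bexI[of _ "step i S (\<lambda>s. s) f"]) (auto simp: dist_norm)
  qed
  then show ?thesis using closed_approachable[OF W(2)] by blast
qed

lemma vimage_closed_subspace:
  assumes "bounded_linear T" "subspace W" "closed W"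
  shows "subspace {f. T f \<in> W}" "closed {f. T f \<in> W}"
  using linear_subspace_vimage[OF bounded_linear.linear[OF assms(1)] assms(2)]
    closed_vimage[OF assms(3) linear_continuous_on[OF assms(1)]]
  by (simp_all add: vimage_def)

lemma closed_subspace_tens:
  fixes f :: "('m::finite) dspace"
  assumes W: "subspace W" "closed W" and gen: "\<And>\<sigma>. tens (\<lambda>i. heav (\<sigma> i)) \<in> W"
  shows "f \<in> W"
proof -
  \<comment> \<open>\<open>F\<close> holds the coordinates on which \<open>f\<close> may still
    depend. \<open>W\<close> varies too, because removing a coordinate passes to the preimage of
    \<open>W\<close> under multiplication by a half-line indicator.\<close>
  have "f \<in> W" if "finite F" "subspace W" "closed W" "\<And>\<sigma>. tens (\<lambda>i. heav (\<sigma> i)) \<in> W"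
    "\<And>t t'. t \<in> cbox 0 1 \<Longrightarrow> t' \<in> cbox 0 1 \<Longrightarrow> (\<And>i. i \<in> F \<Longrightarrow> t $ i = t' $ i) \<Longrightarrow>
       apply_dspace f t = apply_dspace f t'" for f :: "'m dspace" and W F
    using that
  proof (induction F arbitrary: f W)
    case empty
    have "f = apply_dspace f 0 *\<^sub>R tens (\<lambda>i. heav ((\<lambda>_. 0) i))"
    proof (rule dspace_eqI)
      fix t :: "real ^ 'm" assume t: "t \<in> cbox 0 1"
      have "apply_dspace f t = apply_dspace f 0"
        by (rule empty.prems(4)) (use t in \<open>auto simp: mem_box_cart\<close>)
      then show "apply_dspace f t = apply_dspace (apply_dspace f 0 *\<^sub>R tens (\<lambda>i. heav ((\<lambda>_. 0) i))) t"
        using t nth_mem_cube[OF t] by (simp add: regulated_heav heav_def)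
    qed
    moreover have "apply_dspace f 0 *\<^sub>R tens (\<lambda>i. heav ((\<lambda>_. 0) i)) \<in> W"
      by (rule subspace_scale[OF empty.prems(1) empty.prems(3)])
    ultimately show ?case by (rule ssubst)
  next
    case (insert i F)
    show ?case
    proof (rule closed_subspace_coord[OF insert.prems(1,2)])
      fix s c :: real assume c: "c \<in> {0..1}"
      let ?T = "mult_coord i (heav s)"
      have "slice i c f \<in> {g. ?T g \<in> W}"
      proof (rule insert.IH)
        show "subspace {g. ?T g \<in> W}" "closed {g. ?T g \<in> W}"
          using vimage_closed_subspace[OF bounded_linear_heav insert.prems(1,2)] by auto
        fix \<sigma> :: "'m \<Rightarrow> real"
        \<comment> \<open>The product of two half-line indicators is the one with the larger end
          point.\<close>
        have "?T (tens (\<lambda>i. heav (\<sigma> i))) = tens (\<lambda>k. heav ((\<sigma>(i := max s (\<sigma> i))) k))"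
        proof (rule dspace_eqI)
          fix t :: "real ^ 'm" assume t: "t \<in> cbox 0 1"
          have "heav s (t $ i) * (\<Prod>k\<in>UNIV. heav (\<sigma> k) (t $ k)) =
              (\<Prod>k\<in>UNIV. heav ((\<sigma>(i := max s (\<sigma> i))) k) (t $ k))"
            by (subst (1 2) prod.remove[of _ i]) (auto simp: heav_def)
          then show "apply_dspace (?T (tens (\<lambda>i. heav (\<sigma> i)))) t =
              apply_dspace (tens (\<lambda>k. heav ((\<sigma>(i := max s (\<sigma> i))) k))) t"
            using t by (simp add: regulated_heav del: fun_upd_apply)
        qed
        then show "tens (\<lambda>i. heav (\<sigma> i)) \<in> {g. ?T g \<in> W}" using insert.prems(3) by simp
      next
        fix t t' :: "real ^ 'm"
        assume t: "t \<in> cbox 0 1" "t' \<in> cbox 0 1" "\<And>i. i \<in> F \<Longrightarrow> t $ i = t' $ i"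
        then show "apply_dspace (slice i c f) t = apply_dspace (slice i c f) t'"
          using c by (auto intro!: insert.prems(4) upd_mem_cube)
      qed
      then show "?T (slice i c f) \<in> W" by simp
    qed
  qed
  note main = this
  show ?thesis
  proof (rule main[of UNIV, OF finite W gen])
    fix t t' :: "real ^ 'm" assume "\<And>i. i \<in> UNIV \<Longrightarrow> t $ i = t' $ i"
    then have "t = t'" by (simp add: vec_eq_iff)
    then show "apply_dspace f t = apply_dspace f t'" by simp
  qed
qed

section \<open>Dyadic approximation from the right\<close>

definition dyadic :: "nat \<Rightarrow> real set" where
  "dyadic n = (\<lambda>k. real k / 2 ^ n) ` {..2 ^ n}"

lemma dyadic: "finite (dyadic n)" "0 \<in> dyadic n" "dyadic n \<subseteq> {0..1}"
proof -
  have "real k \<le> 2 ^ n" if "k \<le> 2 ^ n" for k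
    using of_nat_mono[OF that, where 'a = real] by simp
  then show "dyadic n \<subseteq> {0..1}" by (auto simp: dyadic_def)
qed (auto simp: dyadic_def intro!: image_eqI[of 0 _ 0])

text \<open>Nested grids make \<open>unext (dyadic n) x\<close> decrease in \<open>n\<close>; the
  bounded variation argument rests on this monotonicity.\<close>

lemma dyadic_mono: "dyadic n \<subseteq> dyadic (Suc n)"
proof
  fix x assume "x \<in> dyadic n"
  then obtain k where k: "k \<le> 2 ^ n" "x = real k / 2 ^ n" by (auto simp: dyadic_def)
  then show "x \<in> dyadic (Suc n)"
    unfolding dyadic_def by (intro image_eqI[of _ _ "2 * k"]) auto
qed

lemma unext:
  assumes "finite S" "S \<subseteq> {0..1}"
  shows "unext S x \<in> {0..1}" "x \<le> 1 \<Longrightarrow> x \<le> unext S x" "s \<in> S \<Longrightarrow> x < s \<Longrightarrow> unext S x \<le> s"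
proof -
  have "unext S x \<in> insert 1 {s \<in> S. x < s}"
    unfolding unext_def by (rule Min_in) (use assms in auto)
  then show "unext S x \<in> {0..1}" "x \<le> 1 \<Longrightarrow> x \<le> unext S x" using assms(2) by auto
  show "s \<in> S \<Longrightarrow> x < s \<Longrightarrow> unext S x \<le> s"
    unfolding unext_def by (rule Min_le) (use assms in auto)
qed

lemma unext_antimono: "finite S' \<Longrightarrow> S \<subseteq> S' \<Longrightarrow> unext S' x \<le> unext S x"
  unfolding unext_def by (rule Min_antimono) auto

lemma unext_rfloor:
  assumes "finite S" "0 \<in> S" "0 \<le> x"
  shows "unext S (rfloor S x) = unext S x"
proof -
  have "{s \<in> S. rfloor S x < s} = {s \<in> S. x < s}"
    using rfloor(3)[OF assms] by (auto simp: not_le[symmetric])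
  then show ?thesis by (simp add: unext_def)
qed

lemma unext_dyadic_le:
  assumes "x \<in> {0..1}"
  shows "unext (dyadic n) x \<le> x + 1 / 2 ^ n"
proof (cases "x < 1")
  case True
  define k where "k = nat \<lfloor>2 ^ n * x\<rfloor> + 1"
  have k: "real k = of_int \<lfloor>2 ^ n * x\<rfloor> + 1" using assms by (simp add: k_def)
  have "2 ^ n * x < real k" "real k \<le> 2 ^ n * x + 1" unfolding k by linarith+
  moreover have "k \<le> 2 ^ n"
  proof -
    have "2 ^ n * x < 2 ^ n" using True by simp
    then have "\<lfloor>2 ^ n * x\<rfloor> < 2 ^ n" by (simp add: floor_less_iff)
    then show ?thesis using assms by (simp add: k_def nat_less_iff Suc_le_eq)
  qed
  ultimately have "real k / 2 ^ n \<in> dyadic n" "x < real k / 2 ^ n" "real k / 2 ^ n \<le> x + 1 / 2 ^ n"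
    by (auto simp: dyadic_def field_simps)
  then show ?thesis using unext(3)[OF dyadic(1,3)] by (meson order_trans)
next
  case False
  then have "x = 1" using assms by auto
  moreover have "unext (dyadic n) x \<le> 1" using unext(1)[OF dyadic(1,3), of n x] by auto
  moreover have "0 \<le> 1 / (2 :: real) ^ n" by simp
  ultimately show ?thesis by linarith
qed

text \<open>The operator P_n of the overview.\<close>

definition dyapp :: "'m \<Rightarrow> nat \<Rightarrow> ('m::finite) dspace \<Rightarrow> 'm dspace" where
  "dyapp i n = step i (dyadic n) (unext (dyadic n))"

lemma apply_dyapp:
  assumes "t \<in> cbox 0 1"
  shows "apply_dspace (dyapp i n f) t = apply_dspace f (upd t i (unext (dyadic n) (t $ i)))"
proof -
  have "unext (dyadic n) ` dyadic n \<subseteq> {0..1}"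
    by (rule image_subsetI) (rule unext(1)[OF dyadic(1,3)])
  from apply_step[OF dyadic(1,2) this assms] show ?thesis
    using nth_mem_cube[OF assms, of i] by (simp add: dyapp_def unext_rfloor dyadic(1,2))
qed

lemma upd_unext_mem_cube: "t \<in> cbox 0 1 \<Longrightarrow> upd t i (unext (dyadic n) x) \<in> cbox 0 1"
  by (intro upd_mem_cube unext(1)[OF dyadic(1,3)])

lemma coord_op_dyapp: "coord_op i (dyapp i n)"
  unfolding dyapp_def by (intro coord_op_step image_subsetI unext(1)[OF dyadic(1,3)])

lemma norm_dyapp_le: "norm (dyapp i n f) \<le> norm f"
  by (rule norm_dspace_le) (simp add: apply_dyapp norm_dspace_ge)

text \<open>Choosing for \<epsilon> the signs of the increments turns the sum of their absolute
  values into \<open>\<phi>\<close> of a single vector of norm at most \<open>C\<close>. The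
  increments are therefore absolutely summable, and they telescope.\<close>

lemma bounded_variation_convergent:
  fixes \<phi> :: "'a :: real_normed_vector \<Rightarrow> real"
  assumes "bounded_linear \<phi>"
    and "\<And>\<epsilon> N. (\<And>n. \<bar>\<epsilon> n\<bar> \<le> 1) \<Longrightarrow> norm (\<Sum>n<N. \<epsilon> n *\<^sub>R (\<psi> n - \<psi> (Suc n))) \<le> C"
  shows "convergent (\<lambda>n. \<phi> (\<psi> n))"
proof -
  interpret bounded_linear \<phi> by fact
  obtain K where K: "K \<ge> 0" "\<And>x. norm (\<phi> x) \<le> norm x * K" using nonneg_bounded by blast
  define d where "d n = \<phi> (\<psi> n) - \<phi> (\<psi> (Suc n))" for n
  have "(\<Sum>n<N. \<bar>d n\<bar>) \<le> C * K" for N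
  proof -
    have "(\<Sum>n<N. \<bar>d n\<bar>) = \<phi> (\<Sum>n<N. sgn (d n) *\<^sub>R (\<psi> n - \<psi> (Suc n)))"
      by (simp add: sum scaleR diff d_def abs_sgn mult.commute)
    also have "\<dots> \<le> norm (\<Sum>n<N. sgn (d n) *\<^sub>R (\<psi> n - \<psi> (Suc n))) * K" using K(2) by (smt (verit) real_norm_def)
    also have "\<dots> \<le> C * K" using assms(2)[of "\<lambda>n. sgn (d n)" N] K(1)
      by (intro mult_right_mono) (auto simp: sgn_if)
    finally show ?thesis .
  qed
  then have "(\<Sum>n\<le>N. \<bar>d n\<bar>) \<le> C * K" for N
    using lessThan_Suc_atMost[of N] by metis
  then have "summable (\<lambda>n. \<bar>d n\<bar>)" by (intro bounded_imp_summable[of _ "C * K"]) simp_all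
  then have "summable d" by (rule summable_rabs_cancel)
  then have "convergent (\<lambda>N. \<phi> (\<psi> 0) - (\<Sum>n<N. d n))"
    by (intro convergent_diff convergent_const) (simp add: summable_iff_convergent)
  moreover have "(\<Sum>n<N. d n) = \<phi> (\<psi> 0) - \<phi> (\<psi> N)" for N
    unfolding d_def by (rule sum_lessThan_telescope')
  ultimately show ?thesis by simp
qed

lemma dyapp_convergent:
  fixes \<phi> :: "('m::finite) dspace \<Rightarrow> real"
  assumes "bounded_linear \<phi>"
  shows "convergent (\<lambda>n. \<phi> (dyapp i n f))"
proof -
  interpret bounded_linear \<phi> by fact
  obtain K where K: "K > 0" "\<And>x. norm (\<phi> x) \<le> norm x * K" using pos_bounded by blast
  have lin: "linear (dyapp i n)" for n
    using coord_op_bounded_linear[OF coord_op_dyapp] bounded_linear.linear by blast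
  define W where "W = {f. convergent (\<lambda>n. \<phi> (dyapp i n f))}"
  have "f \<in> W"
  proof (rule closed_subspace_coord)
    show "subspace W"
      unfolding subspace_def W_def
      by (auto simp: linear_add[OF lin] linear_scale[OF lin] linear_0[OF lin] add scaleR zero
          intro: convergent_add convergent_mult convergent_const)
    \<comment> \<open>The maps \<open>\<phi> \<circ> dyapp i n\<close> are bounded uniformly in
      \<open>n\<close>, so the Cauchy property passes from \<open>g k\<close> to the limit.\<close>
    show "closed W"
      unfolding closed_sequential_limits
    proof (intro allI impI)
      fix g l assume "(\<forall>n. g n \<in> W) \<and> g \<longlonglongrightarrow> l"
      then have g: "\<And>n. g n \<in> W" "g \<longlonglongrightarrow> l" by auto
      have "Cauchy (\<lambda>n. \<phi> (dyapp i n l))"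
      proof (rule metric_CauchyI)
        fix e :: real assume e: "e > 0"
        then have "e / (3 * K) > 0" using K by simp
        from metric_LIMSEQ_D[OF g(2) this] obtain k where k: "norm (g k - l) < e / (3 * K)"
          by (auto simp: dist_norm)
        have close: "\<bar>\<phi> (dyapp i n (g k)) - \<phi> (dyapp i n l)\<bar> < e / 3" for n
        proof -
          have "\<bar>\<phi> (dyapp i n (g k)) - \<phi> (dyapp i n l)\<bar> = norm (\<phi> (dyapp i n (g k - l)))"
            by (simp add: linear_diff[OF lin] diff)
          also have "\<dots> \<le> norm (g k - l) * K"
            using K norm_dyapp_le by (meson mult_right_mono order_trans less_imp_le)
          also have "\<dots> < e / 3" using k K(1) by (simp add: field_simps)
          finally show ?thesis .
        qed
        have "Cauchy (\<lambda>n. \<phi> (dyapp i n (g k)))"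
          using g(1)[of k] by (simp add: W_def convergent_Cauchy)
        from metric_CauchyD[OF this, of "e / 3"] e obtain M where
          M: "\<And>m n. m \<ge> M \<Longrightarrow> n \<ge> M \<Longrightarrow> \<bar>\<phi> (dyapp i m (g k)) - \<phi> (dyapp i n (g k))\<bar> < e / 3"
          by (auto simp: dist_real_def)
        have "dist (\<phi> (dyapp i m l)) (\<phi> (dyapp i n l)) < e" if "m \<ge> M" "n \<ge> M" for m n
          using M[OF that] close[of m] close[of n] unfolding dist_real_def by linarith
        then show "\<exists>M. \<forall>m\<ge>M. \<forall>n\<ge>M. dist (\<phi> (dyapp i m l)) (\<phi> (dyapp i n l)) < e" by blast
      qed
      then show "l \<in> W" by (simp add: W_def real_Cauchy_convergent)
    qed
    fix s c :: real assume c: "c \<in> {0..1}"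
    define u where "u n = unext (dyadic n)" for n
    have app: "apply_dspace (dyapp i n (mult_coord i (heav s) (slice i c f))) t =
        heav s (u n (t $ i)) * apply_dspace f (upd t i c)" if "t \<in> cbox 0 1" for n t
      using that c by (simp add: apply_dyapp upd_unext_mem_cube u_def)
    have "convergent (\<lambda>n. \<phi> (dyapp i n (mult_coord i (heav s) (slice i c f))))"
    proof (rule bounded_variation_convergent[OF assms])
      fix \<epsilon> :: "nat \<Rightarrow> real" and N assume \<epsilon>: "\<And>n. \<bar>\<epsilon> n\<bar> \<le> 1"
      show "norm (\<Sum>n<N. \<epsilon> n *\<^sub>R (dyapp i n (mult_coord i (heav s) (slice i c f))
              - dyapp i (Suc n) (mult_coord i (heav s) (slice i c f)))) \<le> norm f"
      proof (rule norm_dspace_le)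
        fix t :: "real ^ 'm" assume t: "t \<in> cbox 0 1"
        define w where "w n = heav s (u n (t $ i))" for n
        have w: "w (Suc n) \<le> w n" for n
          using unext_antimono[OF dyadic(1) dyadic_mono, of n "t $ i"] by (auto simp: w_def heav_def u_def)
        \<comment> \<open>At each point the values \<open>w n\<close> decrease within [0,1], so no
          choice of signs makes the sum of increments exceed 1.\<close>
        have "\<bar>\<Sum>n<N. \<epsilon> n * (w n - w (Suc n))\<bar> \<le> (\<Sum>n<N. w n - w (Suc n))"
          using w \<epsilon> by (intro order_trans[OF sum_abs] sum_mono) (simp add: abs_mult mult_left_le_one_le)
        also have "\<dots> = w 0 - w N" by (rule sum_lessThan_telescope')
        also have "\<dots> \<le> 1" using heav_bounds unfolding w_def by (smt (verit))
        finally have "\<bar>\<Sum>n<N. \<epsilon> n * (w n - w (Suc n))\<bar> * \<bar>apply_dspace f (upd t i c)\<bar> \<le> 1 * norm f"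
          by (intro mult_mono norm_dspace_ge) auto
        moreover have "apply_dspace (\<Sum>n<N. \<epsilon> n *\<^sub>R (dyapp i n (mult_coord i (heav s) (slice i c f))
              - dyapp i (Suc n) (mult_coord i (heav s) (slice i c f)))) t =
              (\<Sum>n<N. \<epsilon> n * (w n - w (Suc n))) * apply_dspace f (upd t i c)"
          unfolding sum_distrib_right apply_dspace_sum
          by (intro sum.cong refl) (simp add: app[OF t] w_def algebra_simps)
        ultimately show "\<bar>apply_dspace (\<Sum>n<N. \<epsilon> n *\<^sub>R (dyapp i n (mult_coord i (heav s) (slice i c f))
              - dyapp i (Suc n) (mult_coord i (heav s) (slice i c f)))) t\<bar> \<le> norm f"
          by (simp only: abs_mult mult_1)
      qed
    qed
    then show "mult_coord i (heav s) (slice i c f) \<in> W" by (simp add: W_def)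
  qed
  then show ?thesis by (simp add: W_def)
qed

section \<open>Functionals that only see jumps\<close>

text \<open>Stands for continuity in \<open>t_i\<close>, stated as norm convergence of the
  approximants: then \<Upsilon> - \<Lambda> vanishes there by construction, and operators in other
  coordinates preserve the set because they commute with \<open>dyapp i n\<close>.\<close>

definition coord_cont :: "'m \<Rightarrow> ('m::finite) dspace set" where
  "coord_cont i = {f. (\<lambda>n. dyapp i n f) \<longlonglongrightarrow> f}"

text \<open>\<open>dyapp i n\<close> moves \<open>t_i\<close> by at most 1 / 2^n, so a Lipschitz
  factor changes by at most L / 2^n, uniformly on the cube.\<close>

lemma coord_cont_mult:
  assumes h: "regulated h" "\<And>x y. x \<in> {0..1} \<Longrightarrow> y \<in> {0..1} \<Longrightarrow> \<bar>h x - h y\<bar> \<le> L * \<bar>x - y\<bar>" and c: "c \<in> {0..1}"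
    and L: "L \<ge> 0"
  shows "mult_coord i h (slice i c g) \<in> coord_cont i"
proof -
  let ?f = "mult_coord i h (slice i c g)"
  have bd: "norm (dyapp i n ?f - ?f) \<le> L * norm g * (1 / 2 ^ n)" for n
  proof (rule norm_dspace_le)
    fix t :: "real ^ 'a" assume t: "t \<in> cbox 0 1"
    let ?u = "unext (dyadic n) (t $ i)"
    note ti = nth_mem_cube[OF t, of i]
    have u: "?u \<in> {0..1}" "t $ i \<le> ?u" "?u \<le> t $ i + 1 / 2 ^ n"
      using unext(1,2)[OF dyadic(1,3)] unext_dyadic_le[OF ti] ti by auto
    have "\<bar>h ?u - h (t $ i)\<bar> \<le> L * \<bar>?u - t $ i\<bar>" by (rule h(2)[OF u(1) ti])
    also have "\<dots> \<le> L * (1 / 2 ^ n)" using u L by (intro mult_left_mono) auto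
    finally have "\<bar>h ?u - h (t $ i)\<bar> * \<bar>apply_dspace g (upd t i c)\<bar> \<le> L * (1 / 2 ^ n) * norm g"
      by (intro mult_mono norm_dspace_ge) (use L in auto)
    then show "\<bar>apply_dspace (dyapp i n ?f - ?f) t\<bar> \<le> L * norm g * (1 / 2 ^ n)"
      using t c by (simp add: apply_dyapp upd_unext_mem_cube h(1) abs_mult[symmetric] algebra_simps)
  qed
  have "(\<lambda>n. L * norm g * (1 / 2 ^ n)) \<longlonglongrightarrow> L * norm g * 0"
    using LIMSEQ_realpow_zero[of "1 / 2 :: real"] by (intro tendsto_mult tendsto_const) (simp add: power_one_over)
  then have "(\<lambda>n. dyapp i n ?f - ?f) \<longlonglongrightarrow> 0"
    unfolding mult_zero_right by (rule Lim_null_comparison[OF always_eventually[OF allI[OF bd]]])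
  then show ?thesis by (simp add: coord_cont_def LIM_zero_iff)
qed

lemma coord_op_step_commute:
  assumes T: "coord_op k T" "k \<noteq> i" and v: "v ` S \<subseteq> {0..1}"
  shows "T (step i S v f) = step i S v (T f)"
proof -
  have lin: "linear T" using T(1) by (simp add: coord_op_def bounded_linear.linear)
  have "T (slice i (v s) f) = slice i (v s) (T f)" if "s \<in> S" for s
    using that v by (intro coord_op_slice_commute[OF T]) auto
  moreover have "T (mult_coord i (heav s) g) = mult_coord i (heav s) (T g)" for s g
    by (rule coord_op_heav_commute[OF T])
  ultimately show ?thesis
    unfolding step_def linear_sum[OF lin] by (intro sum.cong refl) (simp add: linear_diff[OF lin])
qed

lemma coord_op_dyapp_commute:
  "coord_op k T \<Longrightarrow> k \<noteq> i \<Longrightarrow> T (dyapp i n f) = dyapp i n (T f)"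
  unfolding dyapp_def by (rule coord_op_step_commute[of k T]) (auto intro!: unext(1)[OF dyadic(1,3)] simp del: atLeastAtMost_iff)

lemma coord_op_coord_cont:
  assumes "coord_op k T" "k \<noteq> i" "f \<in> coord_cont i"
  shows "T f \<in> coord_cont i"
  using bounded_linear.tendsto[OF coord_op_bounded_linear[OF assms(1)], of "\<lambda>n. dyapp i n f" f sequentially] assms
  by (simp add: coord_cont_def coord_op_dyapp_commute)

section \<open>Ramps, spikes and the bound for functionals that vanish on
  \<open>coord_cont i\<close>\<close>

definition ramp :: "real \<Rightarrow> real \<Rightarrow> real \<Rightarrow> real" where
  "ramp s \<delta> x = max 0 (min 1 (1 + (x - s) / \<delta>))"

text \<open>The ramp climbs from 0 at \<open>s - \<delta>\<close> to 1 at \<open>s\<close>, so the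
  difference keeps the jump of \<open>heav s\<close> but lives on the open interval between these
  points.\<close>

definition spike :: "real \<Rightarrow> real \<Rightarrow> real \<Rightarrow> real" where
  "spike s \<delta> x = heav s x - ramp s \<delta> x"

lemma regulated_ramp: "regulated (ramp s \<delta>)"
  unfolding ramp_def divide_inverse by (intro regulated_continuous continuous_intros)

lemma regulated_spike: "regulated (spike s \<delta>)"
  unfolding spike_def by (intro regulated_diff regulated_heav regulated_ramp)

lemma ramp_lipschitz:
  assumes "\<delta> > 0"
  shows "\<bar>ramp s \<delta> x - ramp s \<delta> y\<bar> \<le> 1 / \<delta> * \<bar>x - y\<bar>"
proof -
  have "\<bar>ramp s \<delta> x - ramp s \<delta> y\<bar> \<le> \<bar>(x - s) / \<delta> - (y - s) / \<delta>\<bar>"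
    unfolding ramp_def by linarith
  also have "(x - s) / \<delta> - (y - s) / \<delta> = (x - y) / \<delta>" by (simp add: diff_divide_distrib)
  finally show ?thesis using assms by simp
qed

lemma spike_bound: "\<bar>spike s \<delta> x\<bar> \<le> 1"
  unfolding spike_def heav_def ramp_def by (auto simp: max_def min_def)

lemma spike_support:
  assumes "\<delta> > 0" "spike s \<delta> x \<noteq> 0"
  shows "s - \<delta> < x" "x < s"
proof -
  show "x < s"
  proof (rule ccontr)
    assume "\<not> x < s"
    then have "(x - s) / \<delta> \<ge> 0" using assms by simp
    then show False using assms \<open>\<not> x < s\<close> by (simp add: spike_def heav_def ramp_def)
  qed
  then have "ramp s \<delta> x \<noteq> 0" using assms by (simp add: spike_def heav_def)
  then have "- 1 < (x - s) / \<delta>" by (auto simp: ramp_def max_def split: if_splits)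
  then show "s - \<delta> < x" using assms by (simp add: field_simps)
qed

text \<open>With \<delta> at most the least distance within \<open>S\<close>, the supports are
  disjoint and at most one term is nonzero at any \<open>x\<close>; the sum is bounded by the
  largest coefficient and not by their sum.\<close>

lemma spikes_disjoint:
  assumes "finite S"
  obtains \<delta> where "\<delta> > 0"
    "\<And>c B x. (\<And>s. s \<in> S \<Longrightarrow> \<bar>c s\<bar> \<le> B) \<Longrightarrow> 0 \<le> B \<Longrightarrow> \<bar>\<Sum>s\<in>S. c s * spike s \<delta> x\<bar> \<le> B"
proof -
  \<comment> \<open>Removing 0 discards the pairs with equal entries; the 1 covers the case that no
    other pair exists.\<close>
  define D where "D = insert 1 ((\<lambda>(s, s'). \<bar>s - s'\<bar>) ` (S \<times> S) - {0})"
  have D: "finite D" "D \<noteq> {}" "\<And>d. d \<in> D \<Longrightarrow> d > 0" using assms by (auto simp: D_def)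
  define \<delta> where "\<delta> = Min D"
  have \<delta>: "\<delta> > 0" using D by (simp add: \<delta>_def)
  have sep: "\<delta> \<le> \<bar>s - s'\<bar>" if "s \<in> S" "s' \<in> S" "s \<noteq> s'" for s s'
    unfolding \<delta>_def using that by (intro Min_le D(1)) (force simp: D_def)
  show ?thesis
  proof (rule that[OF \<delta>])
    fix c :: "real \<Rightarrow> real" and B x :: real
    assume c: "\<And>s. s \<in> S \<Longrightarrow> \<bar>c s\<bar> \<le> B" and B: "0 \<le> B"
    show "\<bar>\<Sum>s\<in>S. c s * spike s \<delta> x\<bar> \<le> B"
    proof (cases "\<exists>s\<in>S. spike s \<delta> x \<noteq> 0")
      case True
      then obtain s where s: "s \<in> S" "spike s \<delta> x \<noteq> 0" by blast
      have "spike s' \<delta> x = 0" if "s' \<in> S - {s}" for s'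
        using spike_support[OF \<delta> s(2)] spike_support[OF \<delta>, of s' x] sep[OF s(1), of s'] that by force
      then have "(\<Sum>s\<in>S. c s * spike s \<delta> x) = c s * spike s \<delta> x"
        by (simp add: sum.remove[OF assms s(1)])
      also have "\<bar>\<dots>\<bar> \<le> B * 1"
        unfolding abs_mult by (intro mult_mono c s spike_bound) (use B in auto)
      finally show ?thesis by simp
    qed (use B in simp)
  qed
qed

lemma heav_eq_1: "s \<le> 0 \<Longrightarrow> x \<in> {0..1} \<Longrightarrow> heav s x = 1"
  by (simp add: heav_def)

lemma coord_cont_heav:
  assumes "s \<le> 0" "c \<in> {0..1}"
  shows "mult_coord i (heav s) (slice i c g) \<in> coord_cont i"
  by (rule coord_cont_mult[of _ 0]) (use assms in \<open>auto simp: regulated_heav heav_eq_1\<close>)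

lemma coord_cont_ramp:
  assumes "\<delta> > 0" "c \<in> {0..1}"
  shows "mult_coord i (ramp s \<delta>) (slice i c g) \<in> coord_cont i"
  by (rule coord_cont_mult[of _ "1 / \<delta>"]) (use assms ramp_lipschitz regulated_ramp in auto)

text \<open>A ramp times a function free of \<open>t_i\<close> is invisible to
  \<open>\<phi>\<close>, so each half-line may be exchanged for a spike, and disjoint spikes give a
  bound independent of the size of \<open>S\<close>. The condition
  \<open>slice i 0 (g s) = g s\<close> expresses that \<open>g s\<close> does not depend on
  \<open>t_i\<close>.\<close>

lemma jump_bound:
  fixes \<phi> :: "('m::finite) dspace \<Rightarrow> real"
  assumes \<phi>: "bounded_linear \<phi>" "\<And>f. \<bar>\<phi> f\<bar> \<le> norm f * K" "\<And>f. f \<in> coord_cont i \<Longrightarrow> \<phi> f = 0"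
    and S: "finite S" and g: "\<And>s. s \<in> S \<Longrightarrow> slice i 0 (g s) = g s" "\<And>s. s \<in> S \<Longrightarrow> norm (g s) \<le> B"
    and B: "0 \<le> B"
  shows "\<bar>\<phi> (\<Sum>s\<in>S. mult_coord i (heav s) (g s))\<bar> \<le> B * K"
proof -
  interpret bounded_linear \<phi> by fact
  obtain \<delta> where \<delta>: "\<delta> > 0"
    "\<And>c B x. (\<And>s. s \<in> S \<Longrightarrow> \<bar>c s\<bar> \<le> B) \<Longrightarrow> 0 \<le> B \<Longrightarrow> \<bar>\<Sum>s\<in>S. c s * spike s \<delta> x\<bar> \<le> B"
    using spikes_disjoint[OF S] by metis
  have "\<phi> (mult_coord i (heav s) (g s)) = \<phi> (mult_coord i (spike s \<delta>) (g s))" if s: "s \<in> S" for s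
  proof -
    have "mult_coord i (ramp s \<delta>) (slice i 0 (g s)) \<in> coord_cont i"
      by (rule coord_cont_ramp[OF \<delta>(1)]) simp
    moreover have "mult_coord i (heav s) (g s) = mult_coord i (spike s \<delta>) (g s) + mult_coord i (ramp s \<delta>) (g s)"
      by (rule dspace_eqI) (simp add: regulated_spike regulated_ramp spike_def algebra_simps)
    ultimately show ?thesis using \<phi>(3) g(1)[OF s] by (simp add: add)
  qed
  then have "\<bar>\<phi> (\<Sum>s\<in>S. mult_coord i (heav s) (g s))\<bar> = \<bar>\<phi> (\<Sum>s\<in>S. mult_coord i (spike s \<delta>) (g s))\<bar>"
    by (simp add: sum)
  also have "\<dots> \<le> norm (\<Sum>s\<in>S. mult_coord i (spike s \<delta>) (g s)) * K" by (rule \<phi>(2))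
  also have "\<dots> \<le> B * K"
  proof (rule mult_right_mono)
    show "norm (\<Sum>s\<in>S. mult_coord i (spike s \<delta>) (g s)) \<le> B"
    proof (rule norm_dspace_le)
      fix t :: "real ^ 'm"
      have "\<bar>\<Sum>s\<in>S. apply_dspace (g s) t * spike s \<delta> (t $ i)\<bar> \<le> B"
        by (intro \<delta>(2) B) (meson g(2) norm_dspace_ge order_trans)
      then show "\<bar>apply_dspace (\<Sum>s\<in>S. mult_coord i (spike s \<delta>) (g s)) t\<bar> \<le> B"
        by (simp add: regulated_spike mult.commute)
    qed
    \<comment> \<open>Testing with the constant function 1, of norm at least 1, rules out a negative
      \<open>K\<close>.\<close>
    have "\<bar>\<phi> (tens (\<lambda>i. heav 0))\<bar> \<le> norm (tens (\<lambda>i. heav 0) :: 'm dspace) * K" by (rule \<phi>(2))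
    moreover have "norm (tens (\<lambda>i. heav 0) :: 'm dspace) \<ge> 1"
      using norm_dspace_ge[of "tens (\<lambda>i. heav 0)" "0 :: real ^ 'm"]
      by (simp add: regulated_heav heav_def mem_box_cart)
    ultimately show "0 \<le> K" by (smt (verit) mult_nonneg_nonneg zero_le_mult_iff)
  qed
  finally show ?thesis .
qed

section \<open>Summability of the jump coefficients and recovery of a functional from them\<close>

lemma jump_abs_sum_bound:
  fixes \<phi> :: "('m::finite) dspace \<Rightarrow> real"
  assumes \<phi>: "bounded_linear \<phi>" "\<And>f. \<bar>\<phi> f\<bar> \<le> norm f * K" "\<And>f. f \<in> coord_cont i \<Longrightarrow> \<phi> f = 0"
    and S: "finite S" and g: "slice i 0 g = g"
  shows "(\<Sum>s\<in>S. \<bar>\<phi> (mult_coord i (heav s) g)\<bar>) \<le> norm g * K"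
proof -
  interpret bounded_linear \<phi> by fact
  define \<epsilon> where "\<epsilon> s = sgn (\<phi> (mult_coord i (heav s) g))" for s
  have lin: "linear (mult_coord i (heav s))" "linear (slice i 0)" for s
    by (intro bounded_linear.linear bounded_linear_heav bounded_linear_slice; simp)+
  have "\<bar>\<phi> (\<Sum>s\<in>S. mult_coord i (heav s) (\<epsilon> s *\<^sub>R g))\<bar> \<le> norm g * K"
    by (rule jump_bound[OF \<phi> S]) (auto simp: linear_scale[OF lin(2)] g \<epsilon>_def sgn_if)
  moreover have "\<phi> (mult_coord i (heav s) (\<epsilon> s *\<^sub>R g)) = \<bar>\<phi> (mult_coord i (heav s) g)\<bar>" for s
    by (simp add: linear_scale[OF lin(1)] scaleR \<epsilon>_def abs_sgn)
  ultimately show ?thesis by (simp add: sum)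
qed

text \<open>An absolutely summable family is summed over a window to the right of \<open>s\<close>
  that shrinks to \<open>s\<close>. Outside a finite set the family has total mass below the
  tolerance, and the window eventually misses every point of that set other than
  \<open>s\<close>.\<close>

lemma right_sums_tendsto:
  fixes a :: "real \<Rightarrow> real"
  assumes bound: "\<And>S. finite S \<Longrightarrow> (\<Sum>r\<in>S. \<bar>a r\<bar>) \<le> B"
    and zero: "\<And>r. r \<notin> range e \<Longrightarrow> a r = 0"
    and \<delta>: "\<delta> \<longlonglongrightarrow> 0" "\<And>n. \<delta> n > 0"
  shows "(\<lambda>n. \<Sum>r\<in>{r \<in> e ` {..n}. s \<le> r \<and> r < s + \<delta> n}. a r) \<longlonglongrightarrow> a s"
proof (rule LIMSEQ_I)
  fix \<epsilon> :: real assume \<epsilon>: "\<epsilon> > 0"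
  define V where "V = (\<lambda>S. \<Sum>r\<in>S. \<bar>a r\<bar>) ` {S. finite S}"
  have V: "V \<noteq> {}" "bdd_above V" using bound by (auto simp: V_def bdd_above_def)
  have "\<exists>v\<in>V. Sup V - \<epsilon> < v" using less_cSup_iff[OF V, of "Sup V - \<epsilon>"] \<epsilon> by simp
  \<comment> \<open>\<open>F\<close> carries all but \<epsilon> of the supremum of the absolute
    sums, so finite sets disjoint from \<open>F\<close> contribute less than \<epsilon>.\<close>
  then obtain F where F: "finite F" "Sup V - \<epsilon> < (\<Sum>r\<in>F. \<bar>a r\<bar>)" by (auto simp: V_def)
  have tail: "(\<Sum>r\<in>S. \<bar>a r\<bar>) < \<epsilon>" if "finite S" "S \<inter> F = {}" for S
  proof -
    have "(\<Sum>r\<in>F. \<bar>a r\<bar>) + (\<Sum>r\<in>S. \<bar>a r\<bar>) = (\<Sum>r\<in>F \<union> S. \<bar>a r\<bar>)"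
      using that F(1) by (subst sum.union_disjoint) auto
    also have "\<dots> \<le> Sup V" using that F(1) V(2) by (intro cSup_upper) (auto simp: V_def)
    finally show ?thesis using F(2) by linarith
  qed
  obtain n0 where n0: "\<And>n. n \<ge> n0 \<Longrightarrow> s \<in> e ` {..n} \<or> a s = 0"
  proof (cases "s \<in> range e")
    case True
    then obtain k where "s = e k" by blast
    then show ?thesis by (intro that[of k]) auto
  qed (use zero that in blast)
  \<comment> \<open>A lower bound for the distance from \<open>s\<close> to the points of
    \<open>F\<close> on its right, with 1 for the case that there are none.\<close>
  define d where "d = Min (insert 1 ((\<lambda>r. r - s) ` {r \<in> F. s < r}))"
  have d: "d > 0" "\<And>r. r \<in> F \<Longrightarrow> s < r \<Longrightarrow> d \<le> r - s"
    using F(1) by (auto simp: d_def)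
  obtain n1 where n1: "\<And>n. n \<ge> n1 \<Longrightarrow> \<delta> n < d"
    using LIMSEQ_D[OF \<delta>(1) d(1)] by (auto simp: abs_less_iff)
  have "norm ((\<Sum>r\<in>{r \<in> e ` {..n}. s \<le> r \<and> r < s + \<delta> n}. a r) - a s) < \<epsilon>" if n: "n \<ge> max n0 n1" for n
  proof -
    define R where "R = {r \<in> e ` {..n}. s < r \<and> r < s + \<delta> n}"
    have R: "finite R" "R \<inter> F = {}" using n1[of n] d(2) n by (force simp: R_def)+
    have "(\<Sum>r\<in>{r \<in> e ` {..n}. s \<le> r \<and> r < s + \<delta> n}. a r) = a s + (\<Sum>r\<in>R. a r)"
    proof (cases "s \<in> e ` {..n}")
      case True
      then have "{r \<in> e ` {..n}. s \<le> r \<and> r < s + \<delta> n} = insert s R" using \<delta>(2)[of n] by (auto simp: R_def)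
      moreover have "s \<notin> R" by (simp add: R_def)
      ultimately show ?thesis using R(1) by simp
    next
      case False
      then have "a s = 0" using n0[of n] n by auto
      moreover have "{r \<in> e ` {..n}. s \<le> r \<and> r < s + \<delta> n} = R"
        using False by (auto simp: R_def less_le)
      ultimately show ?thesis by simp
    qed
    moreover have "\<bar>\<Sum>r\<in>R. a r\<bar> < \<epsilon>" by (rule le_less_trans[OF sum_abs tail[OF R]])
    ultimately show ?thesis by simp
  qed
  then show "\<exists>no. \<forall>n\<ge>no. norm ((\<Sum>r\<in>{r \<in> e ` {..n}. s \<le> r \<and> r < s + \<delta> n}. a r) - a s) < \<epsilon>" by blast
qed

text \<open>A finite version of the pure jump part of \<open>f\<close> in \<open>t_i\<close>: the
  increment of \<open>f\<close> just before \<open>r\<close> approximates its jump at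
  \<open>r\<close> and is the height of a half-line starting there. Clipping at 0 keeps the left
  point in the cube.\<close>

definition jump_sum :: "'m \<Rightarrow> (nat \<Rightarrow> real) \<Rightarrow> nat \<Rightarrow> ('m::finite) dspace \<Rightarrow> 'm dspace" where
  "jump_sum i e n f = (\<Sum>r\<in>e ` {..n}. mult_coord i (heav r) (slice i r f - slice i (max 0 (r - 1 / real (Suc n))) f))"

text \<open>By \<open>jump_bound\<close> the maps \<open>\<phi> \<circ> jump_sum i e n\<close> are
  bounded uniformly in \<open>n\<close>, so the limit needs checking only on the generators of
  \<open>closed_subspace_coord\<close>. There the increments of \<open>heav s\<close> select the
  points \<open>r\<close> in a window to the right of \<open>s\<close>, and
  \<open>right_sums_tendsto\<close> applies. The hypothesis \<open>vanish\<close> says that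
  \<open>range e\<close> carries all coefficients.\<close>

lemma jump_sum_tendsto:
  fixes \<phi> :: "('m::finite) dspace \<Rightarrow> real"
  assumes \<phi>: "bounded_linear \<phi>" "\<And>f. f \<in> coord_cont i \<Longrightarrow> \<phi> f = 0"
    and e: "range e \<subseteq> {0..1}"
    and vanish: "\<And>s c f. c \<in> {0..1} \<Longrightarrow> s \<notin> range e \<Longrightarrow> \<phi> (mult_coord i (heav s) (slice i c f)) = 0"
  shows "(\<lambda>n. \<phi> (jump_sum i e n f)) \<longlonglongrightarrow> \<phi> f"
proof -
  interpret bounded_linear \<phi> by fact
  obtain K where K: "K > 0" "\<And>f. \<bar>\<phi> f\<bar> \<le> norm f * K" using pos_bounded by auto
  have e01: "r \<in> {0..1}" "max 0 (r - 1 / real (Suc n)) \<in> {0..1}" if "r \<in> e ` A" for r n A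
  proof -
    show r: "r \<in> {0..1}" using e that by blast
    have "0 \<le> 1 / real (Suc n)" by simp
    then have "r - 1 / real (Suc n) \<le> 1" using r unfolding atLeastAtMost_iff by linarith
    then show "max 0 (r - 1 / real (Suc n)) \<in> {0..1}" by simp
  qed
  have sl: "linear (slice i c)" if "c \<in> {0..1}" for c :: real
    using bounded_linear_slice[OF that] by (rule bounded_linear.linear)
  have hv: "linear (mult_coord i (heav s))" for s by (rule bounded_linear.linear[OF bounded_linear_heav])
  have lin: "linear (jump_sum i e n)" for n
    unfolding jump_sum_def[abs_def]
  proof (rule linear_compose_sum, rule ballI)
    fix r assume r: "r \<in> e ` {..n}"
    have "linear (\<lambda>f. slice i r f - slice i (max 0 (r - 1 / real (Suc n))) f)"
      by (intro linear_compose_sub sl e01(1)[OF r] e01(2)[OF r])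
    from linear_compose[OF this hv, of r]
    show "linear (\<lambda>f. mult_coord i (heav r) (slice i r f - slice i (max 0 (r - 1 / real (Suc n))) f))"
      by (simp add: o_def)
  qed
  have bd: "\<bar>\<phi> (jump_sum i e n f)\<bar> \<le> 2 * norm f * K" for n f
    unfolding jump_sum_def
  proof (rule jump_bound[OF \<phi>(1) K(2) \<phi>(2)])
    fix r assume "r \<in> e ` {..n}"
    note r = e01(1)[OF this] e01(2)[OF this, of n]
    show "slice i 0 (slice i r f - slice i (max 0 (r - 1 / real (Suc n))) f) =
        slice i r f - slice i (max 0 (r - 1 / real (Suc n))) f"
      using r by (simp only: linear_diff[OF sl] slice_slice zero_le_one atLeastAtMost_iff order.refl simp_thms)
    have "norm (slice i r f - slice i (max 0 (r - 1 / real (Suc n))) f) \<le> norm f + norm f"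
      by (intro norm_triangle_le_diff add_mono norm_slice_le r)
    then show "norm (slice i r f - slice i (max 0 (r - 1 / real (Suc n))) f) \<le> 2 * norm f" by simp
  qed auto
  define W where "W = {f. (\<lambda>n. \<phi> (jump_sum i e n f)) \<longlonglongrightarrow> \<phi> f}"
  have "f \<in> W"
  proof (rule closed_subspace_coord)
    show "subspace W"
      unfolding subspace_def W_def
      by (auto simp: linear_add[OF lin] linear_scale[OF lin] linear_0[OF lin] add scaleR zero
          intro: tendsto_add tendsto_mult_left)
    show "closed W"
      unfolding closed_sequential_limits
    proof (intro allI impI)
      fix g l assume "(\<forall>n. g n \<in> W) \<and> g \<longlonglongrightarrow> l"
      then have g: "\<And>n. g n \<in> W" "g \<longlonglongrightarrow> l" by auto
      have "(\<lambda>n. \<phi> (jump_sum i e n l)) \<longlonglongrightarrow> \<phi> l"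
      proof (rule LIMSEQ_I)
        fix \<epsilon> :: real assume \<epsilon>: "\<epsilon> > 0"
        then have "\<epsilon> / (6 * K) > 0" using K by simp
        from metric_LIMSEQ_D[OF g(2) this] obtain k where k: "norm (g k - l) < \<epsilon> / (6 * K)"
          by (auto simp: dist_norm)
        then have k': "2 * norm (g k - l) * K < \<epsilon> / 3" "norm (g k - l) * K < \<epsilon> / 3"
          using K(1) \<epsilon> by (simp_all add: field_simps)
        have close: "\<bar>\<phi> (jump_sum i e n (g k)) - \<phi> (jump_sum i e n l)\<bar> < \<epsilon> / 3" for n
          using bd[of n "g k - l"] k'(1) by (simp add: linear_diff[OF lin] diff)
        have close': "\<bar>\<phi> (g k) - \<phi> l\<bar> < \<epsilon> / 3"
          using K(2)[of "g k - l"] k'(2) by (simp add: diff)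
        have "(\<lambda>n. \<phi> (jump_sum i e n (g k))) \<longlonglongrightarrow> \<phi> (g k)" using g(1)[of k] by (simp add: W_def)
        from LIMSEQ_D[OF this, of "\<epsilon> / 3"] \<epsilon> obtain M where
          M: "\<And>n. n \<ge> M \<Longrightarrow> \<bar>\<phi> (jump_sum i e n (g k)) - \<phi> (g k)\<bar> < \<epsilon> / 3"
          by auto
        have "norm (\<phi> (jump_sum i e n l) - \<phi> l) < \<epsilon>" if "n \<ge> M" for n
          using M[OF that] close[of n] close' unfolding real_norm_def by linarith
        then show "\<exists>M. \<forall>n\<ge>M. norm (\<phi> (jump_sum i e n l) - \<phi> l) < \<epsilon>" by blast
      qed
      then show "l \<in> W" by (simp add: W_def)
    qed
    fix s c :: real assume c: "c \<in> {0..1}"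
    define g where "g = slice i c f"
    define a where "a r = \<phi> (mult_coord i (heav r) g)" for r
    have sl_g: "mult_coord i (heav r) (slice i a (mult_coord i (heav s) g)) = heav s a *\<^sub>R mult_coord i (heav r) g"
      if "a \<in> {0..1}" for a r
      by (simp add: slice_heav[OF that] g_def slice_slice[OF that c] linear_scale[OF hv])
    have "jump_sum i e n (mult_coord i (heav s) g) =
        (\<Sum>r\<in>e ` {..n}. (heav s r - heav s (max 0 (r - 1 / real (Suc n)))) *\<^sub>R mult_coord i (heav r) g)" for n
      unfolding jump_sum_def
    proof (intro sum.cong refl)
      fix r assume "r \<in> e ` {..n}"
      note r = e01(1)[OF this] e01(2)[OF this, of n]
      show "mult_coord i (heav r) (slice i r (mult_coord i (heav s) g) -
             slice i (max 0 (r - 1 / real (Suc n))) (mult_coord i (heav s) g)) =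
         (heav s r - heav s (max 0 (r - 1 / real (Suc n)))) *\<^sub>R mult_coord i (heav r) g"
        unfolding linear_diff[OF hv] scaleR_diff_left by (simp only: sl_g[OF r(1)] sl_g[OF r(2)])
    qed
    then have js: "\<phi> (jump_sum i e n (mult_coord i (heav s) g)) =
        (\<Sum>r\<in>e ` {..n}. (heav s r - heav s (max 0 (r - 1 / real (Suc n)))) * a r)" for n
      by (simp add: sum scaleR a_def)
    have "(\<lambda>n. \<phi> (jump_sum i e n (mult_coord i (heav s) g))) \<longlonglongrightarrow> a s"
    proof (cases "s \<le> 0")
      case True
      have "a s = 0" unfolding a_def g_def by (intro \<phi>(2) coord_cont_heav True c)
      moreover have "heav s r - heav s (max 0 (r - 1 / real (Suc n))) = 0" if "r \<in> e ` {..n}" for r n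
        using True e01(1)[OF that] by (simp add: heav_def)
      ultimately show ?thesis by (simp add: js)
    next
      case False
      have "(\<lambda>n. \<Sum>r\<in>{r \<in> e ` {..n}. s \<le> r \<and> r < s + 1 / real (Suc n)}. a r) \<longlonglongrightarrow> a s"
      proof (rule right_sums_tendsto)
        show "(\<Sum>r\<in>S. \<bar>a r\<bar>) \<le> norm g * K" if "finite S" for S
          unfolding a_def by (rule jump_abs_sum_bound[OF \<phi>(1) K(2) \<phi>(2) that]) (use c in \<open>simp_all add: g_def\<close>)
        show "a r = 0" if "r \<notin> range e" for r unfolding a_def g_def by (rule vanish[OF c that])
        show "(\<lambda>n. 1 / real (Suc n)) \<longlonglongrightarrow> 0" using LIMSEQ_inverse_real_of_nat by (simp add: inverse_eq_divide)
      qed simp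
      moreover have "(\<Sum>r\<in>{r \<in> e ` {..n}. s \<le> r \<and> r < s + 1 / real (Suc n)}. a r) =
          \<phi> (jump_sum i e n (mult_coord i (heav s) g))" for n
        unfolding js
      proof (intro sum.mono_neutral_cong_left)
        \<comment> \<open>For \<open>s > 0\<close> the clipping at 0 leaves the value of
          \<open>heav s\<close> unchanged, and the increment from \<open>r - d\<close> to
          \<open>r\<close> is 1 exactly when \<open>r - d < s \<le> r\<close>.\<close>
        have "heav s r - heav s (max 0 (r - d)) = (if s \<le> r \<and> r < s + d then 1 else 0)" if "0 < d" for r d
          using False that by (auto simp: heav_def max_def)
        from this[of "1 / real (Suc n)"]
        have "heav s r - heav s (max 0 (r - 1 / real (Suc n))) = (if s \<le> r \<and> r < s + 1 / real (Suc n) then 1 else 0)" for r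
          by simp
        then show "\<forall>r\<in>e ` {..n} - {r \<in> e ` {..n}. s \<le> r \<and> r < s + 1 / real (Suc n)}.
            (heav s r - heav s (max 0 (r - 1 / real (Suc n)))) * a r = 0"
          "\<And>r. r \<in> {r \<in> e ` {..n}. s \<le> r \<and> r < s + 1 / real (Suc n)} \<Longrightarrow>
             a r = (heav s r - heav s (max 0 (r - 1 / real (Suc n)))) * a r"
          by auto
      qed auto
      ultimately show ?thesis by simp
    qed
    then show "mult_coord i (heav s) (slice i c f) \<in> W" by (simp add: W_def a_def g_def)
  qed
  then show ?thesis by (simp add: W_def)
qed

section \<open>Multilinear forms and their jump coefficients\<close>

definition map_arg :: "'l \<Rightarrow> ('a \<Rightarrow> 'a) \<Rightarrow> ('l \<Rightarrow> 'a) \<Rightarrow> 'l \<Rightarrow> 'a" where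
  "map_arg j T x = x(j := T (x j))"

lemma map_arg_commute:
  "(j = k \<Longrightarrow> S (T (x j)) = T (S (x j))) \<Longrightarrow> map_arg j S (map_arg k T x) = map_arg k T (map_arg j S x)"
  by (auto simp: map_arg_def fun_eq_iff)

lemma bounded_multilinear_linear:
  "bounded_multilinear \<Upsilon> \<Longrightarrow> linear (\<lambda>y. \<Upsilon> (x(i := y)))"
  by (simp add: bounded_multilinear_def)

lemma bounded_multilinear_bound:
  fixes \<Upsilon> :: "('l::finite \<Rightarrow> 'a::real_normed_vector) \<Rightarrow> 'b::real_normed_vector"
  assumes "bounded_multilinear \<Upsilon>"
  obtains C where "C \<ge> 0" "\<And>x. norm (\<Upsilon> x) \<le> C * (\<Prod>i\<in>UNIV. norm (x i))"
proof -
  obtain C where C: "\<And>x. norm (\<Upsilon> x) \<le> C * (\<Prod>i\<in>UNIV. norm (x i))"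
    using assms by (auto simp: bounded_multilinear_def)
  have "C * (\<Prod>i\<in>UNIV. norm (x i)) \<le> max C 0 * (\<Prod>i\<in>UNIV. norm (x i))" for x :: "'l \<Rightarrow> 'a"
    by (intro mult_right_mono prod_nonneg) auto
  then show ?thesis using C by (intro that[of "max C 0"]) (auto intro: order_trans)
qed

lemma bounded_multilinear_bounded_linear:
  fixes \<Upsilon> :: "('l::finite \<Rightarrow> 'a::real_normed_vector) \<Rightarrow> 'b::real_normed_vector"
  assumes "bounded_multilinear \<Upsilon>"
  shows "bounded_linear (\<lambda>y. \<Upsilon> (x(i := y)))"
proof -
  obtain C where C: "\<And>x. norm (\<Upsilon> x) \<le> C * (\<Prod>i\<in>UNIV. norm (x i))"
    using bounded_multilinear_bound[OF assms] by blast
  have "norm (\<Upsilon> (x(i := y))) \<le> norm y * (C * (\<Prod>k\<in>UNIV - {i}. norm (x k)))" for y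
    using C[of "x(i := y)"] by (simp add: prod.remove[of _ i] mult_ac)
  then show ?thesis
    using bounded_multilinear_linear[OF assms]
    by (intro bounded_linear.intro bounded_linear_axioms.intro) blast+
qed

lemma prod_norm_map_arg_le:
  fixes x :: "'l::finite \<Rightarrow> 'a::real_normed_vector"
  assumes "norm (T (x j)) \<le> norm (x j) * K"
  shows "(\<Prod>i\<in>UNIV. norm (map_arg j T x i)) \<le> K * (\<Prod>i\<in>UNIV. norm (x i))"
proof -
  have "(\<Prod>i\<in>UNIV. norm (map_arg j T x i)) = norm (T (x j)) * (\<Prod>i\<in>UNIV - {j}. norm (x i))"
    by (simp add: prod.remove[of _ j] map_arg_def)
  also have "\<dots> \<le> norm (x j) * K * (\<Prod>i\<in>UNIV - {j}. norm (x i))"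
    by (intro mult_right_mono assms prod_nonneg) auto
  also have "\<dots> = K * (\<Prod>i\<in>UNIV. norm (x i))" by (simp add: prod.remove[of _ j] mult_ac)
  finally show ?thesis .
qed

lemma linear_map_arg:
  assumes "bounded_multilinear \<Upsilon>" "linear T"
  shows "linear (\<lambda>y. \<Upsilon> (map_arg j T (x(i := y))))"
proof (cases "i = j")
  case True
  then have "(\<lambda>y. \<Upsilon> (map_arg j T (x(i := y)))) = (\<lambda>y. \<Upsilon> (x(j := y))) \<circ> T"
    by (simp add: map_arg_def fun_eq_iff)
  then show ?thesis
    using linear_compose[OF assms(2) bounded_multilinear_linear[OF assms(1)]] by simp
next
  case False
  then have "map_arg j T (x(i := y)) = (map_arg j T x)(i := y)" for y
    by (auto simp: map_arg_def fun_eq_iff)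
  then show ?thesis using bounded_multilinear_linear[OF assms(1)] by simp
qed

lemma bounded_multilinear_map_arg:
  assumes \<Upsilon>: "bounded_multilinear \<Upsilon>" and T: "bounded_linear T"
  shows "bounded_multilinear (\<lambda>x. \<Upsilon> (map_arg j T x))"
  unfolding bounded_multilinear_def
proof (intro conjI allI)
  fix i x
  show "linear (\<lambda>y. \<Upsilon> (map_arg j T (x(i := y))))"
    by (rule linear_map_arg[OF \<Upsilon> bounded_linear.linear[OF T]])
next
  obtain C where C: "C \<ge> 0" "\<And>x. norm (\<Upsilon> x) \<le> C * (\<Prod>i\<in>UNIV. norm (x i))"
    using bounded_multilinear_bound[OF \<Upsilon>] by blast
  obtain K where K: "\<And>x. norm (T x) \<le> norm x * K" using bounded_linear.bounded[OF T] by blast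
  have "norm (\<Upsilon> (map_arg j T x)) \<le> C * K * (\<Prod>i\<in>UNIV. norm (x i))" for x
    using order_trans[OF C(2)[of "map_arg j T x"] mult_left_mono[OF prod_norm_map_arg_le[of T x j, OF K] C(1)]]
    by (simp only: mult.assoc)
  then show "\<exists>C. \<forall>x. norm (\<Upsilon> (map_arg j T x)) \<le> C * (\<Prod>i\<in>UNIV. norm (x i))" by blast
qed

lemma bounded_multilinear_diff:
  fixes \<Upsilon> \<Lambda> :: "('l::finite \<Rightarrow> 'a::real_normed_vector) \<Rightarrow> 'b::real_normed_vector"
  assumes "bounded_multilinear \<Upsilon>" "bounded_multilinear \<Lambda>"
  shows "bounded_multilinear (\<lambda>x. \<Upsilon> x - \<Lambda> x)"
  unfolding bounded_multilinear_def
proof (intro conjI allI)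
  fix i x
  show "linear (\<lambda>y. \<Upsilon> (x(i := y)) - \<Lambda> (x(i := y)))"
    by (intro linear_compose_sub bounded_multilinear_linear assms)
next
  obtain C D where "\<And>x. norm (\<Upsilon> x) \<le> C * (\<Prod>i\<in>UNIV. norm (x i))"
      "\<And>x. norm (\<Lambda> x) \<le> D * (\<Prod>i\<in>UNIV. norm (x i))"
    using assms bounded_multilinear_bound by metis
  then have "norm (\<Upsilon> x - \<Lambda> x) \<le> (C + D) * (\<Prod>i\<in>UNIV. norm (x i))" for x
    by (intro norm_triangle_le_diff) (simp add: distrib_right add_mono)
  then show "\<exists>C. \<forall>x. norm (\<Upsilon> x - \<Lambda> x) \<le> C * (\<Prod>i\<in>UNIV. norm (x i))" by blast
qed

lemma bounded_multilinear_tendsto: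
  fixes \<Upsilon> :: "nat \<Rightarrow> ('l::finite \<Rightarrow> 'a::real_normed_vector) \<Rightarrow> 'b::real_normed_vector"
  assumes \<Upsilon>: "\<And>n i x. linear (\<lambda>y. \<Upsilon> n (x(i := y)))"
    and bd: "\<And>n x. norm (\<Upsilon> n x) \<le> C * (\<Prod>i\<in>UNIV. norm (x i))"
    and lim: "\<And>x. (\<lambda>n. \<Upsilon> n x) \<longlonglongrightarrow> \<Lambda> x"
  shows "bounded_multilinear \<Lambda>"
  unfolding bounded_multilinear_def
proof (intro conjI allI exI)
  fix i x
  show "linear (\<lambda>y. \<Lambda> (x(i := y)))"
  proof (rule linearI)
    fix y z
    have "(\<lambda>n. \<Upsilon> n (x(i := y + z))) \<longlonglongrightarrow> \<Lambda> (x(i := y)) + \<Lambda> (x(i := z))"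
      unfolding linear_add[OF \<Upsilon>] by (intro tendsto_add lim)
    then show "\<Lambda> (x(i := y + z)) = \<Lambda> (x(i := y)) + \<Lambda> (x(i := z))"
      by (rule LIMSEQ_unique[OF lim])
  next
    fix r y
    have "(\<lambda>n. \<Upsilon> n (x(i := r *\<^sub>R y))) \<longlonglongrightarrow> r *\<^sub>R \<Lambda> (x(i := y))"
      unfolding linear_scale[OF \<Upsilon>] by (intro tendsto_scaleR tendsto_const lim)
    then show "\<Lambda> (x(i := r *\<^sub>R y)) = r *\<^sub>R \<Lambda> (x(i := y))"
      by (rule LIMSEQ_unique[OF lim])
  qed
next
  fix x
  show "norm (\<Lambda> x) \<le> C * (\<Prod>i\<in>UNIV. norm (x i))"
    by (rule tendsto_upperbound[OF tendsto_norm[OF lim]]) (use bd in auto)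
qed

text \<open>Density of the span of the products of half-line indicators, used in one argument at a
  time; \<open>J\<close> is the set of arguments that are still arbitrary.\<close>

lemma bounded_multilinear_eq_0:
  fixes \<Upsilon> :: "('l::finite \<Rightarrow> ('m::finite) dspace) \<Rightarrow> real"
  assumes \<Upsilon>: "bounded_multilinear \<Upsilon>" and zero: "\<And>\<sigma>. \<Upsilon> (\<lambda>j. tens (\<lambda>i. heav (\<sigma> j i))) = 0"
  shows "\<Upsilon> x = 0"
proof -
  have "\<forall>x. (\<forall>j. j \<notin> J \<longrightarrow> x j \<in> range (\<lambda>\<sigma>. tens (\<lambda>i. heav (\<sigma> i)))) \<longrightarrow> \<Upsilon> x = 0"
    if "finite J" for J :: "'l set"
    using that
  proof induction
    case empty
    show ?case
    proof (intro allI impI)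
      fix x :: "'l \<Rightarrow> 'm dspace"
      assume "\<forall>j. j \<notin> {} \<longrightarrow> x j \<in> range (\<lambda>\<sigma>. tens (\<lambda>i. heav (\<sigma> i)))"
      then have "\<forall>j. \<exists>\<sigma>. x j = tens (\<lambda>i. heav (\<sigma> i))" by blast
      from choice[OF this] obtain \<sigma> where "\<And>j. x j = tens (\<lambda>i. heav (\<sigma> j i))" by blast
      then have "x = (\<lambda>j. tens (\<lambda>i. heav (\<sigma> j i)))" by (rule ext)
      then show "\<Upsilon> x = 0" using zero[of \<sigma>] by simp
    qed
  next
    case (insert k J)
    show ?case
    proof (intro allI impI)
      fix x :: "'l \<Rightarrow> 'm dspace"
      assume x: "\<forall>j. j \<notin> insert k J \<longrightarrow> x j \<in> range (\<lambda>\<sigma>. tens (\<lambda>i. heav (\<sigma> i)))"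
      let ?T = "\<lambda>y. \<Upsilon> (x(k := y))"
      have "x k \<in> {y. ?T y \<in> {0}}"
      proof (rule closed_subspace_tens)
        show "subspace {y. ?T y \<in> {0}}" "closed {y. ?T y \<in> {0}}"
          using vimage_closed_subspace[OF bounded_multilinear_bounded_linear[OF \<Upsilon>, of x k] subspace_single_0 closed_singleton]
          by auto
        show "tens (\<lambda>i. heav (\<sigma> i)) \<in> {y. ?T y \<in> {0}}" for \<sigma>
          using x insert.IH by auto
      qed
      then show "\<Upsilon> x = 0" by simp
    qed
  qed
  from this[of UNIV] show ?thesis by simp
qed

text \<open>Over independent random signs the right-hand side has the left-hand side as its mean, so
  some choice must dominate. Here the signs are chosen greedily.\<close>

lemma ex_signs_sum_squares:
  fixes a :: "'s \<Rightarrow> 't \<Rightarrow> real"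
  assumes "finite S"
  shows "\<exists>\<epsilon>. (\<forall>s. \<bar>\<epsilon> s\<bar> \<le> 1) \<and> (\<Sum>s\<in>S. \<Sum>t\<in>T. (a s t)\<^sup>2) \<le> (\<Sum>t\<in>T. (\<Sum>s\<in>S. \<epsilon> s * a s t)\<^sup>2)"
  using assms
proof induction
  case empty
  then show ?case by (intro exI[of _ "\<lambda>_. 0"]) simp
next
  case (insert r S)
  then obtain \<epsilon> where \<epsilon>: "\<And>s. \<bar>\<epsilon> s\<bar> \<le> (1 :: real)"
    "(\<Sum>s\<in>S. \<Sum>t\<in>T. (a s t)\<^sup>2) \<le> (\<Sum>t\<in>T. (\<Sum>s\<in>S. \<epsilon> s * a s t)\<^sup>2)" by blast
  define X where "X t = (\<Sum>s\<in>S. \<epsilon> s * a s t)" for t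
  \<comment> \<open>This sign makes the cross term between the new row and the previous combination
    nonnegative.\<close>
  define \<eta> :: real where "\<eta> = (if (\<Sum>t\<in>T. a r t * X t) \<ge> 0 then 1 else - 1)"
  have "(\<Sum>t\<in>T. (\<Sum>s\<in>insert r S. (\<epsilon>(r := \<eta>)) s * a s t)\<^sup>2) = (\<Sum>t\<in>T. (\<eta> * a r t + X t)\<^sup>2)"
  proof (intro sum.cong refl)
    fix t
    have "(\<Sum>s\<in>S. (\<epsilon>(r := \<eta>)) s * a s t) = X t"
      unfolding X_def using insert.hyps by (intro sum.cong) auto
    then show "(\<Sum>s\<in>insert r S. (\<epsilon>(r := \<eta>)) s * a s t)\<^sup>2 = (\<eta> * a r t + X t)\<^sup>2"
      using insert.hyps by simp
  qed
  also have "\<dots> = (\<Sum>t\<in>T. (a r t)\<^sup>2 + (X t)\<^sup>2 + 2 * \<eta> * (a r t * X t))"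
    by (intro sum.cong refl) (auto simp: \<eta>_def power2_eq_square algebra_simps)
  also have "\<dots> = (\<Sum>t\<in>T. (a r t)\<^sup>2) + (\<Sum>t\<in>T. (X t)\<^sup>2) + 2 * \<eta> * (\<Sum>t\<in>T. a r t * X t)"
    by (simp add: sum.distrib sum_distrib_left)
  also have "\<dots> \<ge> (\<Sum>t\<in>T. (a r t)\<^sup>2) + (\<Sum>s\<in>S. \<Sum>t\<in>T. (a s t)\<^sup>2)"
    using \<epsilon>(2) by (auto simp: X_def[symmetric] \<eta>_def)
  finally have "(\<Sum>s\<in>insert r S. \<Sum>t\<in>T. (a s t)\<^sup>2) \<le>
      (\<Sum>t\<in>T. (\<Sum>s\<in>insert r S. (\<epsilon>(r := \<eta>)) s * a s t)\<^sup>2)"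
    using insert.hyps by simp
  moreover have "\<bar>(\<epsilon>(r := \<eta>)) s\<bar> \<le> 1" for s using \<epsilon>(1) by (simp add: \<eta>_def)
  ultimately show ?case by blast
qed

section \<open>Values at products of one-variable functions, with pairs (argument, coordinate) as
  one index set\<close>

definition tens_form ::
    "(('l \<Rightarrow> ('m::finite) dspace) \<Rightarrow> real) \<Rightarrow> ('l \<times> 'm \<Rightarrow> real \<Rightarrow> real) \<Rightarrow> real" where
  "tens_form \<Upsilon> h = \<Upsilon> (\<lambda>j. tens (\<lambda>i. h (j, i)))"

lemma tens_form_upd:
  "tens_form \<Upsilon> (h((j, i) := g)) = \<Upsilon> ((\<lambda>j. tens (\<lambda>i. h (j, i)))(j := tens ((\<lambda>i. h (j, i))(i := g))))"
  unfolding tens_form_def by (rule arg_cong[of _ _ \<Upsilon>]) (auto simp: fun_eq_iff intro!: arg_cong[of _ _ tens])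

lemma prod_upd:
  fixes h :: "'m::finite \<Rightarrow> real \<Rightarrow> real"
  shows "(\<Prod>k\<in>UNIV. (h(i := g)) k (t k)) = g (t i) * (\<Prod>k\<in>UNIV - {i}. h k (t k))"
  by (simp add: prod.remove[of _ i])

lemma apply_tens_upd:
  assumes "\<And>k. regulated (h k)" "regulated g" "t \<in> cbox 0 1"
  shows "apply_dspace (tens (h(i := g))) t = g (t $ i) * (\<Prod>k\<in>UNIV - {i}. h k (t $ k))"
proof -
  have "\<And>k. regulated ((h(i := g)) k)" using assms by simp
  then show ?thesis using assms(3) prod_upd[of h i g "\<lambda>k. t $ k"] by (simp del: fun_upd_apply)
qed

lemma tens_upd_sum:
  assumes "\<And>k. regulated (h k)" "\<And>a. a \<in> A \<Longrightarrow> regulated (g a)"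
  shows "tens (h(i := (\<lambda>x. \<Sum>a\<in>A. c a * g a x))) = (\<Sum>a\<in>A. c a *\<^sub>R tens (h(i := g a)))"
proof (rule dspace_eqI)
  fix t :: "real ^ 'a" assume t: "t \<in> cbox 0 1"
  have "regulated (\<lambda>x. \<Sum>a\<in>A. c a * g a x)"
    by (intro regulated_sum regulated_cmult assms(2))
  then show "apply_dspace (tens (h(i := (\<lambda>x. \<Sum>a\<in>A. c a * g a x)))) t =
      apply_dspace (\<Sum>a\<in>A. c a *\<^sub>R tens (h(i := g a))) t"
    by (simp add: apply_tens_upd assms t sum_distrib_right mult.assoc del: apply_tens)
qed

lemma tens_form_upd_sum:
  assumes "bounded_multilinear \<Upsilon>" "\<And>p. regulated (h p)" "\<And>a. a \<in> A \<Longrightarrow> regulated (g a)"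
  shows "tens_form \<Upsilon> (h(p := (\<lambda>x. \<Sum>a\<in>A. c a * g a x))) = (\<Sum>a\<in>A. c a * tens_form \<Upsilon> (h(p := g a)))"
proof (cases p)
  case (Pair j i)
  have lin: "linear (\<lambda>y. \<Upsilon> ((\<lambda>j. tens (\<lambda>i. h (j, i)))(j := y)))"
    by (rule bounded_multilinear_linear[OF assms(1)])
  show ?thesis
    using assms(2,3)
    by (simp add: Pair tens_form_upd tens_upd_sum linear_sum[OF lin] linear_scale[OF lin] del: fun_upd_apply)
qed

text \<open>\<open>heav 0\<close> is the constant 1 on [0,1]; as a factor it stands for independence
  of that coordinate.\<close>

lemma tens_upd_eq_mult:
  assumes "\<And>k. regulated (h k)" "regulated g"
  shows "tens (h(i := g)) = mult_coord i g (slice i 0 (tens (h(i := heav 0))))"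
proof (rule dspace_eqI)
  fix t :: "real ^ 'a" assume t: "t \<in> cbox 0 1"
  have "upd t i 0 \<in> cbox 0 1" by (intro upd_mem_cube t) auto
  then show "apply_dspace (tens (h(i := g))) t = apply_dspace (mult_coord i g (slice i 0 (tens (h(i := heav 0))))) t"
    using t by (simp add: apply_tens_upd assms regulated_heav heav_def del: apply_tens cong: prod.cong_simp)
qed

lemma slice_tens_upd:
  assumes "\<And>k. regulated (h k)" "regulated g" "c \<in> {0..1}"
  shows "slice i c (tens (h(i := g))) = g c *\<^sub>R tens (h(i := heav 0))"
proof (rule dspace_eqI)
  fix t :: "real ^ 'a" assume t: "t \<in> cbox 0 1"
  have "upd t i c \<in> cbox 0 1" by (intro upd_mem_cube t assms)
  then show "apply_dspace (slice i c (tens (h(i := g)))) t = apply_dspace (g c *\<^sub>R tens (h(i := heav 0))) t"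
    using t assms(3) nth_mem_cube[OF t, of i]
    by (simp add: apply_tens_upd assms regulated_heav heav_def del: apply_tens cong: prod.cong_simp)
qed

lemma sum_PiE_insert:
  assumes "q \<notin> F"
  shows "(\<Sum>s\<in>Pi\<^sub>E (insert q F) (\<lambda>_. S). f s) = (\<Sum>r\<in>S. \<Sum>s\<in>Pi\<^sub>E F (\<lambda>_. S). f (s(q := r)))"
proof -
  have "(\<Sum>s\<in>Pi\<^sub>E (insert q F) (\<lambda>_. S). f s) = (\<Sum>(r, s)\<in>S \<times> Pi\<^sub>E F (\<lambda>_. S). f (s(q := r)))"
    unfolding PiE_insert_eq using inj_combinator[OF assms, of "\<lambda>_. S"]
    by (subst sum.reindex) (auto simp: case_prod_unfold o_def)
  then show ?thesis by (simp add: sum.cartesian_product)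
qed

text \<open>One pair at a time: \<open>ex_signs_sum_squares\<close> chooses the signs for
  \<open>q\<close> with the other indices as columns, and linearity collects the signed sum into a
  single factor. That factor is fixed from then on, whence the induction over arbitrary
  \<open>h\<close>.\<close>

lemma ex_signs_tens_form:
  fixes \<Upsilon> :: "('l::finite \<Rightarrow> ('m::finite) dspace) \<Rightarrow> real"
  assumes \<Upsilon>: "bounded_multilinear \<Upsilon>" and S: "finite S" and F: "finite F" and h: "\<And>p. regulated (h p)"
  shows "\<exists>\<epsilon>. (\<forall>p s. \<bar>\<epsilon> p s\<bar> \<le> 1) \<and>
    (\<Sum>s\<in>Pi\<^sub>E F (\<lambda>_. S). (tens_form \<Upsilon> (\<lambda>p. if p \<in> F then heav (s p) else h p))\<^sup>2) \<le>
    (tens_form \<Upsilon> (\<lambda>p. if p \<in> F then (\<lambda>x. \<Sum>r\<in>S. \<epsilon> p r * heav r x) else h p))\<^sup>2"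
  using F h
proof (induction F arbitrary: h)
  case empty
  then show ?case by (intro exI[of _ "\<lambda>_ _. 0"]) simp
next
  case (insert q F)
  define a where "a r s = tens_form \<Upsilon> (\<lambda>p. if p \<in> F then heav (s p) else (h(q := heav r)) p)" for r s
  obtain \<eta> where \<eta>: "\<And>s. \<bar>\<eta> s\<bar> \<le> (1::real)"
    "(\<Sum>r\<in>S. \<Sum>s\<in>Pi\<^sub>E F (\<lambda>_. S). (a r s)\<^sup>2) \<le> (\<Sum>s\<in>Pi\<^sub>E F (\<lambda>_. S). (\<Sum>r\<in>S. \<eta> r * a r s)\<^sup>2)"
    using ex_signs_sum_squares[OF S, where T = "Pi\<^sub>E F (\<lambda>_. S)" and a = a] by blast
  define h' where "h' = h(q := (\<lambda>x. \<Sum>r\<in>S. \<eta> r * heav r x))"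
  have h': "regulated (h' p)" for p
    using insert.prems regulated_sum[of S "\<lambda>r x. \<eta> r * heav r x"] regulated_cmult[OF regulated_heav]
    by (simp add: h'_def)
  have lin: "(\<Sum>r\<in>S. \<eta> r * a r s) = tens_form \<Upsilon> (\<lambda>p. if p \<in> F then heav (s p) else h' p)" for s
  proof -
    define k where "k p = (if p \<in> F then heav (s p) else h p)" for p
    have k: "regulated (k p)" for p using insert.prems by (simp add: k_def regulated_heav)
    have "(\<lambda>p. if p \<in> F then heav (s p) else (h(q := g)) p) = k(q := g)" for g
      using insert.hyps by (auto simp: k_def fun_eq_iff)
    then show ?thesis
      unfolding a_def h'_def using tens_form_upd_sum[where h = k and g = heav and A = S and p = q and c = \<eta>, OF \<Upsilon> k regulated_heav] by simp
  qed
  obtain \<epsilon> where \<epsilon>: "\<And>p s. \<bar>\<epsilon> p s\<bar> \<le> (1::real)"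
    "(\<Sum>s\<in>Pi\<^sub>E F (\<lambda>_. S). (tens_form \<Upsilon> (\<lambda>p. if p \<in> F then heav (s p) else h' p))\<^sup>2) \<le>
     (tens_form \<Upsilon> (\<lambda>p. if p \<in> F then (\<lambda>x. \<Sum>r\<in>S. \<epsilon> p r * heav r x) else h' p))\<^sup>2"
    using insert.IH[of h', OF h'] by blast
  have "(\<lambda>p. if p \<in> insert q F then heav ((s(q := r)) p) else h p) =
      (\<lambda>p. if p \<in> F then heav (s p) else (h(q := heav r)) p)" for s :: "'l \<times> 'm \<Rightarrow> real" and r
    using insert.hyps by (auto simp: fun_eq_iff)
  then have "(\<Sum>s\<in>Pi\<^sub>E (insert q F) (\<lambda>_. S). (tens_form \<Upsilon> (\<lambda>p. if p \<in> insert q F then heav (s p) else h p))\<^sup>2) =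
      (\<Sum>r\<in>S. \<Sum>s\<in>Pi\<^sub>E F (\<lambda>_. S). (a r s)\<^sup>2)"
    by (simp add: sum_PiE_insert[OF insert.hyps(2)] a_def del: fun_upd_apply insert_iff)
  also note \<eta>(2)
  also note \<epsilon>(2)[folded lin]
  also have "(\<lambda>p. if p \<in> F then (\<lambda>x. \<Sum>r\<in>S. \<epsilon> p r * heav r x) else h' p) =
      (\<lambda>p. if p \<in> insert q F then (\<lambda>x. \<Sum>r\<in>S. (\<epsilon>(q := \<eta>)) p r * heav r x) else h p)"
    using insert.hyps by (auto simp: fun_eq_iff h'_def)
  finally show ?case using \<epsilon>(1) \<eta>(1) by (intro exI[of _ "\<epsilon>(q := \<eta>)"]) auto
qed

definition kills_cont :: "(('l \<Rightarrow> ('m::finite) dspace) \<Rightarrow> real) \<Rightarrow> 'l \<times> 'm \<Rightarrow> bool" where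
  "kills_cont \<Upsilon> = (\<lambda>(j, i). \<forall>x. x j \<in> coord_cont i \<longrightarrow> \<Upsilon> x = 0)"

text \<open>Phrased as invariance under \<open>slice i c\<close>, so that it survives composition
  with any operator that commutes with the slice.\<close>

definition fixed_slice :: "(('l \<Rightarrow> ('m::finite) dspace) \<Rightarrow> real) \<Rightarrow> 'l \<times> 'm \<Rightarrow> bool" where
  "fixed_slice \<Upsilon> = (\<lambda>(j, i). \<exists>c\<in>{0..1}. \<forall>x. \<Upsilon> (map_arg j (slice i c) x) = \<Upsilon> x)"

lemma tens_form_ramp:
  assumes "kills_cont \<Upsilon> p" "\<And>p. regulated (h p)" "\<delta> > 0"
  shows "tens_form \<Upsilon> (h(p := ramp s \<delta>)) = 0"
proof (cases p)
  case (Pair j i)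
  have "tens ((\<lambda>i. h (j, i))(i := ramp s \<delta>)) \<in> coord_cont i"
    using coord_cont_ramp[OF assms(3), of 0] assms(2) by (simp add: tens_upd_eq_mult regulated_ramp)
  then show ?thesis using assms(1) Pair by (simp add: tens_form_upd kills_cont_def)
qed

lemma tens_form_spikes:
  assumes \<Upsilon>: "bounded_multilinear \<Upsilon>" and p: "kills_cont \<Upsilon> p" and h: "\<And>p. regulated (h p)" and \<delta>: "\<delta> > 0"
  shows "tens_form \<Upsilon> (h(p := (\<lambda>x. \<Sum>r\<in>S. c r * heav r x))) =
    tens_form \<Upsilon> (h(p := (\<lambda>x. \<Sum>r\<in>S. c r * spike r \<delta> x)))"
proof -
  have "tens_form \<Upsilon> (h(p := heav r)) = tens_form \<Upsilon> (h(p := spike r \<delta>))" for r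
  proof -
    \<comment> \<open>The two-term decomposition is indexed by truth values to fit the additivity
      lemma for finite sums.\<close>
    have "heav r = (\<lambda>x. \<Sum>b\<in>{True, False}. 1 * (if b then spike r \<delta> else ramp r \<delta>) x)"
      by (simp add: fun_eq_iff spike_def)
    then have "tens_form \<Upsilon> (h(p := heav r)) =
        (\<Sum>b\<in>{True, False}. 1 * tens_form \<Upsilon> (h(p := (if b then spike r \<delta> else ramp r \<delta>))))"
      using tens_form_upd_sum[where A = "{True, False}" and g = "\<lambda>b. if b then spike r \<delta> else ramp r \<delta>"
          and p = p and c = "\<lambda>_. 1", OF \<Upsilon> h] regulated_spike regulated_ramp by simp
    then show ?thesis using tens_form_ramp[OF p h \<delta>] by simp
  qed
  then show ?thesis
    by (simp add: tens_form_upd_sum[OF \<Upsilon> h] regulated_heav regulated_spike)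
qed

text \<open>On any finite grid, signs bound the sum of squared coefficients by the square of one
  value of the form, and spikes replace half-lines in that value. All factors are then bounded by 1,
  so the value is at most \<open>C\<close> in modulus, whatever the grid. Taking \<open>s\<close> in
  \<open>extensional Z\<close> counts each coefficient once; otherwise the irrelevant values off
  \<open>Z\<close> would make the set uncountable.\<close>

lemma countable_tens_form_support:
  fixes \<Upsilon> :: "('l::finite \<Rightarrow> ('m::finite) dspace) \<Rightarrow> real"
  assumes \<Upsilon>: "bounded_multilinear \<Upsilon>" and Z: "\<And>p. p \<in> Z \<Longrightarrow> kills_cont \<Upsilon> p"
  shows "countable {s \<in> extensional Z. tens_form \<Upsilon> (\<lambda>p. if p \<in> Z then heav (s p) else heav 0) \<noteq> 0}"
proof -
  define b where "b s = tens_form \<Upsilon> (\<lambda>p. if p \<in> Z then heav (s p) else heav 0)" for s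
  obtain C where C: "C \<ge> 0" "\<And>x. norm (\<Upsilon> x) \<le> C * (\<Prod>i\<in>UNIV. norm (x i))"
    using bounded_multilinear_bound[OF \<Upsilon>] by blast
  have bd: "(\<Sum>s\<in>Pi\<^sub>E Z (\<lambda>_. S). (b s)\<^sup>2) \<le> C\<^sup>2" if S: "finite S" for S
  proof -
    obtain \<epsilon> where \<epsilon>: "\<And>p s. \<bar>\<epsilon> p s\<bar> \<le> (1::real)"
      "(\<Sum>s\<in>Pi\<^sub>E Z (\<lambda>_. S). (b s)\<^sup>2) \<le>
       (tens_form \<Upsilon> (\<lambda>p. if p \<in> Z then (\<lambda>x. \<Sum>r\<in>S. \<epsilon> p r * heav r x) else heav 0))\<^sup>2"
      using ex_signs_tens_form[OF \<Upsilon> S, of Z "\<lambda>_. heav 0", OF finite regulated_heav] unfolding b_def by blast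
    obtain \<delta> where \<delta>: "\<delta> > 0"
      "\<And>c B x. (\<And>s. s \<in> S \<Longrightarrow> \<bar>c s\<bar> \<le> B) \<Longrightarrow> 0 \<le> B \<Longrightarrow> \<bar>\<Sum>s\<in>S. c s * spike s \<delta> x\<bar> \<le> B"
      using spikes_disjoint[OF S] by metis
    define u where "u p = (\<lambda>x. \<Sum>r\<in>S. \<epsilon> p r * heav r x)" for p
    define v where "v p = (\<lambda>x. \<Sum>r\<in>S. \<epsilon> p r * spike r \<delta> x)" for p
    have reg: "regulated (u p)" "regulated (v p)" for p
      unfolding u_def v_def by (intro regulated_sum regulated_cmult regulated_heav regulated_spike)+
    \<comment> \<open>The exchange takes place in one factor at a time; \<open>F\<close> holds the
      pairs already converted to spikes.\<close>
    have "tens_form \<Upsilon> (\<lambda>p. if p \<in> Z then u p else heav 0) =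
        tens_form \<Upsilon> (\<lambda>p. if p \<in> F then v p else if p \<in> Z then u p else heav 0)"
      if "finite F" "F \<subseteq> Z" for F
      using that
    proof (induction F)
      case (insert q F)
      define k where "k p = (if p \<in> F then v p else if p \<in> Z then u p else heav 0)" for p
      have k: "regulated (k p)" for p by (simp add: k_def reg regulated_heav)
      have "k(q := u q) = k" using insert by (auto simp: k_def fun_eq_iff)
      moreover have "k(q := v q) = (\<lambda>p. if p \<in> insert q F then v p else if p \<in> Z then u p else heav 0)"
        by (auto simp: k_def fun_eq_iff)
      moreover have "tens_form \<Upsilon> (k(q := u q)) = tens_form \<Upsilon> (k(q := v q))"
        unfolding u_def v_def using insert.prems by (intro tens_form_spikes[OF \<Upsilon> Z k \<delta>(1)]) auto
      ultimately show ?case using insert by (simp add: k_def[abs_def])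
    qed simp
    from this[of Z] have eq: "tens_form \<Upsilon> (\<lambda>p. if p \<in> Z then u p else heav 0) =
        tens_form \<Upsilon> (\<lambda>p. if p \<in> Z then v p else heav 0)"
      by (simp cong: if_cong)
    define w where "w p = (if p \<in> Z then v p else heav 0)" for p
    have w: "regulated (w p)" "\<bar>w p x\<bar> \<le> 1" for p x
      using reg regulated_heav heav_bounds(3) \<delta>(2)[of "\<epsilon> p" 1 x] \<epsilon>(1) by (auto simp: w_def v_def)
    have "norm (tens (\<lambda>i. w (j, i))) \<le> 1" for j
    proof (rule norm_dspace_le)
      fix t :: "real ^ 'm" assume "t \<in> cbox 0 1"
      then have "\<bar>apply_dspace (tens (\<lambda>i. w (j, i))) t\<bar> = (\<Prod>i\<in>UNIV. \<bar>w (j, i) (t $ i)\<bar>)"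
        by (simp add: w(1) abs_prod)
      also have "\<dots> \<le> 1" by (intro prod_le_1) (simp add: w(2))
      finally show "\<bar>apply_dspace (tens (\<lambda>i. w (j, i))) t\<bar> \<le> 1" .
    qed
    then have le: "(\<Prod>j\<in>UNIV. norm (tens (\<lambda>i. w (j, i)))) \<le> 1" by (intro prod_le_1) simp
    have "\<bar>tens_form \<Upsilon> w\<bar> \<le> C * (\<Prod>j\<in>UNIV. norm (tens (\<lambda>i. w (j, i))))"
      unfolding tens_form_def using C(2)[of "\<lambda>j. tens (\<lambda>i. w (j, i))"] by simp
    also have "\<dots> \<le> C * 1" by (rule mult_left_mono[OF le C(1)])
    finally have "\<bar>tens_form \<Upsilon> w\<bar> \<le> C * 1" .
    then have "(tens_form \<Upsilon> w)\<^sup>2 \<le> C\<^sup>2" using C(1) by (simp add: abs_le_square_iff[symmetric])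
    then show ?thesis using \<epsilon>(2)[folded u_def] unfolding eq w_def[abs_def] by (rule order_trans[rotated])
  qed
  have "(\<lambda>s. (b s)\<^sup>2) summable_on extensional Z"
  proof (rule nonneg_bdd_above_summable_on)
    show "bdd_above (sum (\<lambda>s. (b s)\<^sup>2) ` {F. F \<subseteq> extensional Z \<and> finite F})"
    proof (rule bdd_aboveI2)
      fix F :: "('l \<times> 'm \<Rightarrow> real) set" assume F: "F \<in> {F. F \<subseteq> extensional Z \<and> finite F}"
      \<comment> \<open>All values that occur, so that the finite set \<open>F\<close> lies in the
        grid of functions from \<open>Z\<close> to \<open>S\<close>.\<close>
      define S where "S = (\<Union>s\<in>F. s ` Z)"
      have S: "finite S" using F by (auto simp: S_def)
      have "sum (\<lambda>s. (b s)\<^sup>2) F \<le> sum (\<lambda>s. (b s)\<^sup>2) (Pi\<^sub>E Z (\<lambda>_. S))"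
        using F S by (intro sum_mono2 finite_PiE) (auto simp: S_def PiE_def)
      then show "sum (\<lambda>s. (b s)\<^sup>2) F \<le> C\<^sup>2" using bd[OF S] by simp
    qed
  qed simp
  from summable_countable_real[OF this] show ?thesis by (simp add: b_def)
qed

section \<open>Measurability\<close>

lemma measurable_apply_dspace:
  assumes "c \<in> cbox 0 1"
  shows "(\<lambda>f. apply_dspace f c) \<in> borel_measurable evaluation_algebra"
proof (rule measurableI)
  fix B :: "real set" assume "B \<in> sets borel"
  then have "{f. apply_dspace f c \<in> B} \<in> {{f. apply_dspace f t \<in> B} | t B. t \<in> cbox 0 1 \<and> B \<in> sets borel}"
    using assms by blast
  then show "(\<lambda>f. apply_dspace f c) -` B \<inter> space evaluation_algebra \<in> sets evaluation_algebra"
    unfolding evaluation_algebra_def by (simp add: vimage_def sigma_sets.Basic)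
qed simp

text \<open>Together with its analogue for \<open>kills_cont\<close>, this ensures that treating the
  pair \<open>(j, i)\<close> does not spoil what was achieved for the others.\<close>

lemma fixed_slice_map_arg:
  assumes T: "coord_op i T" and q: "q \<noteq> (j, i)" and \<Upsilon>: "fixed_slice \<Upsilon> q"
  shows "fixed_slice (\<lambda>x. \<Upsilon> (map_arg j T x)) q"
proof -
  obtain k l where kl: "q = (k, l)" by (cases q)
  obtain c where c: "c \<in> {0..1}" "\<And>x. \<Upsilon> (map_arg k (slice l c) x) = \<Upsilon> x"
    using \<Upsilon> by (auto simp: fixed_slice_def kl)
  have "map_arg j T (map_arg k (slice l c) x) = map_arg k (slice l c) (map_arg j T x)" for x
    using q by (intro map_arg_commute coord_op_slice_commute[OF T _ c(1)]) (auto simp: kl)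
  then show ?thesis
    unfolding fixed_slice_def kl prod.case using c by (intro bexI[of _ c] allI) simp_all
qed

lemma kills_cont_map_arg:
  assumes T: "coord_op i T" and q: "q \<noteq> (j, i)" and \<Upsilon>: "kills_cont \<Upsilon> q"
  shows "kills_cont (\<lambda>x. \<Upsilon> (map_arg j T x)) q"
proof -
  obtain k l where kl: "q = (k, l)" by (cases q)
  have "\<Upsilon> (map_arg j T x) = 0" if "x k \<in> coord_cont l" for x
  proof -
    have "map_arg j T x k \<in> coord_cont l"
      using q that coord_op_coord_cont[OF T, of l "x k"] by (auto simp: map_arg_def kl)
    then show ?thesis using \<Upsilon> by (auto simp: kills_cont_def kl)
  qed
  then show ?thesis by (auto simp: kills_cont_def kl)
qed

lemma fixed_slice_map_arg_slice:
  assumes "c \<in> {0..1}"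
  shows "fixed_slice (\<lambda>x. \<Upsilon> (map_arg j (\<lambda>f. T (slice i c f)) x)) (j, i)"
proof -
  have "map_arg j (\<lambda>f. T (slice i c f)) (map_arg j (slice i c) x) = map_arg j (\<lambda>f. T (slice i c f)) x" for x
    by (simp add: map_arg_def slice_slice[OF assms assms])
  then show ?thesis
    unfolding fixed_slice_def prod.case using assms by (intro bexI[of _ c] allI) simp_all
qed

lemma coord_op_heav_slice: "c \<in> {0..1} \<Longrightarrow> coord_op i (\<lambda>f. mult_coord i (heav s) (slice i c f))"
  by (rule coord_op_comp[OF coord_op_heav coord_op_slice])

text \<open>Freezing all coordinates in turn leaves only the value at \<open>c\<close>.
  \<open>F\<close> holds the coordinates still to be frozen: where they agree with \<open>c\<close>,
  the current function vanishes.\<close>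

lemma fixed_slices_eq_0:
  fixes \<Upsilon> :: "('l::finite \<Rightarrow> ('m::finite) dspace) \<Rightarrow> real"
  assumes \<Upsilon>: "bounded_multilinear \<Upsilon>"
    and c: "\<And>i. c $ i \<in> {0..1}" "\<And>i x. \<Upsilon> (map_arg j (slice i (c $ i)) x) = \<Upsilon> x"
    and f: "apply_dspace f c = 0"
  shows "\<Upsilon> (x(j := f)) = 0"
proof -
  have "\<Upsilon> (x(j := f)) = 0"
    if "finite F" "\<And>t. t \<in> cbox 0 1 \<Longrightarrow> (\<And>i. i \<in> F \<Longrightarrow> t $ i = c $ i) \<Longrightarrow> apply_dspace f t = 0" for F f
    using that
  proof (induction F arbitrary: f)
    case empty
    then have "f = 0" by (intro dspace_eqI) simp
    then show ?case using linear_0[OF bounded_multilinear_linear[OF \<Upsilon>, of x j]] by (simp only:)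
  next
    case (insert i F)
    have "\<Upsilon> (x(j := slice i (c $ i) f)) = 0"
    proof (rule insert.IH)
      fix t :: "real ^ 'm" assume t: "t \<in> cbox 0 1" "\<And>i. i \<in> F \<Longrightarrow> t $ i = c $ i"
      then have "apply_dspace f (upd t i (c $ i)) = 0"
        using c(1) by (intro insert.prems upd_mem_cube) auto
      then show "apply_dspace (slice i (c $ i) f) t = 0" using c(1)[of i] by simp
    qed
    then have "\<Upsilon> (x(j := f)) = 0" using c(2)[of i "x(j := f)"] by (simp add: map_arg_def)
    then show ?case by (simp only:)
  qed
  note main = this
  show ?thesis
  proof (rule main[of UNIV])
    fix t assume "\<And>i. i \<in> UNIV \<Longrightarrow> t $ i = c $ i"
    then have "t = c" by (simp add: vec_eq_iff)
    then show "apply_dspace f t = 0" using f by simp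
  qed simp
qed

lemma fixed_slices_measurable:
  fixes \<Upsilon> :: "('l::finite \<Rightarrow> ('m::finite) dspace) \<Rightarrow> real"
  assumes \<Upsilon>: "bounded_multilinear \<Upsilon>" and fixed: "\<And>p. fixed_slice \<Upsilon> p"
  shows "\<Upsilon> \<in> borel_measurable (\<Pi>\<^sub>M i\<in>UNIV. evaluation_algebra)"
proof -
  have "\<forall>p. \<exists>c\<in>{0..1}. \<forall>x. \<Upsilon> (map_arg (fst p) (slice (snd p) c) x) = \<Upsilon> x"
    using fixed by (auto simp: fixed_slice_def case_prod_unfold)
  from choice[OF this[unfolded Bex_def]] obtain d where
    d: "\<And>p. d p \<in> {0..1}" "\<And>p x. \<Upsilon> (map_arg (fst p) (slice (snd p) (d p)) x) = \<Upsilon> x"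
    by blast
  define c where "c j = (\<chi> i. d (j, i))" for j
  have c: "c j $ i \<in> {0..1}" "\<Upsilon> (map_arg j (slice i (c j $ i)) x) = \<Upsilon> x" for i j x
    using d(1)[of "(j, i)"] d(2)[of "(j, i)"] by (auto simp: c_def)
  have cube: "c j \<in> cbox 0 1" for j using c(1) by (simp add: mem_box_cart)
  define e :: "'m dspace" where "e = tens (\<lambda>i. heav 0)"
  have e: "apply_dspace e (c j) = 1" for j
    using cube[of j] nth_mem_cube[OF cube[of j]] by (simp add: e_def regulated_heav heav_def)
  \<comment> \<open>Subtracting from \<open>x j\<close> its value at \<open>c j\<close> times the
    constant 1 leaves a function that vanishes at \<open>c j\<close>, which the form does not
    see.\<close>
  have eval: "\<Upsilon> x = apply_dspace (x j) (c j) * \<Upsilon> (x(j := e))" for x j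
  proof -
    have "\<Upsilon> (x(j := x j - apply_dspace (x j) (c j) *\<^sub>R e)) = 0"
      by (rule fixed_slices_eq_0[OF \<Upsilon> c]) (simp add: e)
    then show ?thesis
      using linear_diff[OF bounded_multilinear_linear[OF \<Upsilon>], of x j]
        linear_scale[OF bounded_multilinear_linear[OF \<Upsilon>], of x j] by simp
  qed
  have "\<Upsilon> x = (\<Prod>j\<in>J. apply_dspace (x j) (c j)) * \<Upsilon> (\<lambda>j. if j \<in> J then e else x j)" if "finite J" for J x
    using that
  proof induction
    case (insert k J)
    have "(\<lambda>j. if j \<in> J then e else x j)(k := e) = (\<lambda>j. if j \<in> insert k J then e else x j)" by auto
    then show ?case
      using insert eval[of "\<lambda>j. if j \<in> J then e else x j" k] by (simp add: mult_ac)
  qed simp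
  note main = this
  define K where "K = \<Upsilon> (\<lambda>_. e)"
  have eq: "\<Upsilon> = (\<lambda>x. (\<Prod>j\<in>UNIV. apply_dspace (x j) (c j)) * K)"
  proof
    fix x
    show "\<Upsilon> x = (\<Prod>j\<in>UNIV. apply_dspace (x j) (c j)) * K"
      using main[of UNIV x] by (simp add: K_def)
  qed
  have "(\<lambda>x. apply_dspace (x j) (c j)) \<in> borel_measurable (\<Pi>\<^sub>M i\<in>UNIV. evaluation_algebra)" for j :: 'l
    using measurable_compose[OF measurable_component_singleton[of j UNIV "\<lambda>_. evaluation_algebra"]
        measurable_apply_dspace[OF cube]] by simp
  then show ?thesis
    unfolding eq by (intro borel_measurable_times borel_measurable_prod borel_measurable_const)
qed

text \<open>If cutting at \<open>r\<close> leaves a nonzero form, density yields a nonzero value on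
  products of indicators with \<open>r\<close> at place \<open>(j, i)\<close>. Hence
  \<open>r\<close> is an entry of a point in the countable coefficient support.\<close>

lemma countable_jump_points:
  fixes \<Upsilon> :: "('l::finite \<Rightarrow> ('m::finite) dspace) \<Rightarrow> real"
  assumes \<Upsilon>: "bounded_multilinear \<Upsilon>" and good: "\<And>q. fixed_slice \<Upsilon> q \<or> kills_cont \<Upsilon> q"
    and p: "kills_cont \<Upsilon> (j, i)"
  shows "countable {r. \<exists>x. \<exists>c\<in>{0..1}. \<Upsilon> (map_arg j (\<lambda>f. mult_coord i (heav r) (slice i c f)) x) \<noteq> 0}"
proof -
  define Z where "Z = {q. kills_cont \<Upsilon> q}"
  define I where "I = {s \<in> extensional Z. tens_form \<Upsilon> (\<lambda>p. if p \<in> Z then heav (s p) else heav 0) \<noteq> 0}"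
  have "countable I"
    unfolding I_def by (rule countable_tens_form_support[OF \<Upsilon>]) (simp add: Z_def)
  have "r \<in> (\<lambda>s. s (j, i)) ` I"
    if c: "c \<in> {0..1}" and nz: "\<Upsilon> (map_arg j (\<lambda>f. mult_coord i (heav r) (slice i c f)) x) \<noteq> 0" for r x c
  proof -
    let ?T = "\<lambda>f. mult_coord i (heav r) (slice i c f)"
    have "bounded_multilinear (\<lambda>x. \<Upsilon> (map_arg j ?T x))"
      by (rule bounded_multilinear_map_arg[OF \<Upsilon> coord_op_bounded_linear[OF coord_op_heav_slice[OF c]]])
    from bounded_multilinear_eq_0[OF this, of x] nz obtain \<sigma> where
      \<sigma>: "\<Upsilon> (map_arg j ?T (\<lambda>j. tens (\<lambda>i. heav (\<sigma> j i)))) \<noteq> 0" by blast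
    define \<tau> where "\<tau> = (\<lambda>(k, l). \<sigma> k l)((j, i) := r)"
    have "?T (tens (\<lambda>i. heav (\<sigma> j i))) = heav (\<sigma> j i) c *\<^sub>R tens ((\<lambda>i. heav (\<sigma> j i))(i := heav r))"
    proof -
      define h where "h = (\<lambda>i. heav (\<sigma> j i))"
      have h: "regulated (h k)" for k by (simp add: h_def regulated_heav)
      have z: "slice i 0 (tens (h(i := heav 0))) = tens (h(i := heav 0))"
        using slice_tens_upd[where c = 0 and i = i and g = "heav 0", OF h regulated_heav] by (simp add: heav_def)
      have "slice i c (tens (h(i := h i))) = h i c *\<^sub>R tens (h(i := heav 0))"
        by (rule slice_tens_upd[OF h h c])
      then have "?T (tens h) = h i c *\<^sub>R mult_coord i (heav r) (tens (h(i := heav 0)))"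
        by (simp only: fun_upd_triv linear_scale[OF bounded_linear.linear[OF bounded_linear_heav]])
      also have "mult_coord i (heav r) (tens (h(i := heav 0))) = tens (h(i := heav r))"
        unfolding tens_upd_eq_mult[where i = i and g = "heav r", OF h regulated_heav] z ..
      finally show ?thesis by (simp only: h_def)
    qed
    then have "\<Upsilon> (map_arg j ?T (\<lambda>j. tens (\<lambda>i. heav (\<sigma> j i)))) =
        heav (\<sigma> j i) c * tens_form \<Upsilon> ((\<lambda>(k, l). heav (\<sigma> k l))((j, i) := heav r))"
      by (simp add: map_arg_def tens_form_upd linear_scale[OF bounded_multilinear_linear[OF \<Upsilon>]])
    moreover have "(\<lambda>(k, l). heav (\<sigma> k l))((j, i) := heav r) = (\<lambda>q. heav (\<tau> q))"
      by (auto simp: \<tau>_def fun_eq_iff)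
    ultimately have \<tau>: "tens_form \<Upsilon> (\<lambda>q. heav (\<tau> q)) \<noteq> 0" using \<sigma> by auto
    \<comment> \<open>A pair outside \<open>Z\<close> is frozen on a slice \<open>d\<close>, so its
      indicator contributes only the scalar \<open>h q d\<close> and can be exchanged for
      \<open>heav 0\<close>; a nonzero value cannot have a zero scalar.\<close>
    have "tens_form \<Upsilon> (\<lambda>q. if q \<in> F then heav 0 else heav (\<tau> q)) \<noteq> 0"
      if "finite F" "F \<inter> Z = {}" for F
      using that
    proof induction
      case (insert q F)
      define h where "h q = (if q \<in> F then heav 0 else heav (\<tau> q))" for q
      have h: "regulated (h q)" for q by (simp add: h_def regulated_heav)
      obtain k l where q: "q = (k, l)" by (cases q)
      have "fixed_slice \<Upsilon> q" using good[of q] insert.prems by (auto simp: Z_def)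
      then obtain d where d: "d \<in> {0..1}" "\<And>x. \<Upsilon> (map_arg k (slice l d) x) = \<Upsilon> x"
        by (auto simp: fixed_slice_def q)
      let ?y = "\<lambda>j. tens (\<lambda>i. h (j, i))"
      have "tens_form \<Upsilon> h = \<Upsilon> (map_arg k (slice l d) ?y)" by (simp add: tens_form_def d(2))
      also have "map_arg k (slice l d) ?y = ?y(k := h q d *\<^sub>R tens ((\<lambda>i. h (k, i))(l := heav 0)))"
        using slice_tens_upd[of "\<lambda>i. h (k, i)" "h q" d l] h d(1) by (simp add: map_arg_def q fun_upd_idem)
      also have "\<Upsilon> \<dots> = h q d * tens_form \<Upsilon> (h(q := heav 0))"
        unfolding q tens_form_upd using linear_scale[OF bounded_multilinear_linear[OF \<Upsilon>], of ?y k] by simp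
      also have "h(q := heav 0) = (\<lambda>p. if p \<in> insert q F then heav 0 else heav (\<tau> p))"
        by (auto simp: h_def fun_eq_iff)
      finally show ?case using insert by (auto simp: h_def[abs_def])
    qed (use \<tau> in simp)
    from this[of "- Z"] have "tens_form \<Upsilon> (\<lambda>q. if q \<in> - Z then heav 0 else heav (\<tau> q)) \<noteq> 0"
      by simp
    moreover have "(\<lambda>q. if q \<in> - Z then heav 0 else heav (\<tau> q)) =
        (\<lambda>q. if q \<in> Z then heav (restrict \<tau> Z q) else heav 0)"
      by auto
    ultimately have "restrict \<tau> Z \<in> I" by (simp add: I_def)
    moreover have "restrict \<tau> Z (j, i) = r" using p by (simp add: Z_def \<tau>_def)
    ultimately show ?thesis by (intro image_eqI[of _ _ "restrict \<tau> Z"]) simp_all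
  qed
  then have "{r. \<exists>x. \<exists>c\<in>{0..1}. \<Upsilon> (map_arg j (\<lambda>f. mult_coord i (heav r) (slice i c f)) x) \<noteq> 0} \<subseteq> (\<lambda>s. s (j, i)) ` I"
    by blast
  then show ?thesis using \<open>countable I\<close> by (meson countable_image countable_subset)
qed

text \<open>Induction on the number of pairs that are not frozen. A jump pair is expanded by
  \<open>jump_sum\<close> along its countably many jump points; each term of the finite sums freezes
  that pair and falls under the induction hypothesis.\<close>

lemma jump_form_measurable:
  fixes \<Upsilon> :: "('l::finite \<Rightarrow> ('m::finite) dspace) \<Rightarrow> real"
  assumes "bounded_multilinear \<Upsilon>" and "\<And>q. fixed_slice \<Upsilon> q \<or> kills_cont \<Upsilon> q"
  shows "\<Upsilon> \<in> borel_measurable (\<Pi>\<^sub>M i\<in>UNIV. evaluation_algebra)"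
  using assms
proof (induction "card {q. \<not> fixed_slice \<Upsilon> q}" arbitrary: \<Upsilon> rule: less_induct)
  case less
  note \<Upsilon> = less.prems(1) and good = less.prems(2)
  show ?case
  proof (cases "\<forall>p. fixed_slice \<Upsilon> p")
    case True
    then show ?thesis by (intro fixed_slices_measurable[OF \<Upsilon>]) blast
  next
    case False
    then obtain j i where p: "\<not> fixed_slice \<Upsilon> (j, i)" by auto
    then have kills: "kills_cont \<Upsilon> (j, i)" using good by blast
    have cut: "(\<lambda>x. \<Upsilon> (map_arg j (\<lambda>f. mult_coord i (heav r) (slice i c f)) x))
        \<in> borel_measurable (\<Pi>\<^sub>M i\<in>UNIV. evaluation_algebra)" if c: "c \<in> {0..1}" for r c
    proof (rule less.hyps)
      let ?\<Lambda> = "\<lambda>x. \<Upsilon> (map_arg j (\<lambda>f. mult_coord i (heav r) (slice i c f)) x)"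
      note T = coord_op_heav_slice[OF c, of i r]
      show "bounded_multilinear ?\<Lambda>"
        by (rule bounded_multilinear_map_arg[OF \<Upsilon> coord_op_bounded_linear[OF T]])
      have fix_p: "fixed_slice ?\<Lambda> (j, i)" by (rule fixed_slice_map_arg_slice[OF c])
      have fix_q: "fixed_slice ?\<Lambda> q" if "fixed_slice \<Upsilon> q" for q
        using fix_p fixed_slice_map_arg[OF T _ that, of j] by (cases "q = (j, i)") auto
      show "fixed_slice ?\<Lambda> q \<or> kills_cont ?\<Lambda> q" for q
        using fix_p good[of q] fix_q[of q] kills_cont_map_arg[OF T, of q j \<Upsilon>] by (cases "q = (j, i)") auto
      show "card {q. \<not> fixed_slice ?\<Lambda> q} < card {q. \<not> fixed_slice \<Upsilon> q}"
        by (rule psubset_card_mono) (use fix_q fix_p p in auto)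
    qed
    define N where "N = {r \<in> {0..1}. \<exists>x. \<exists>c\<in>{0..1}. \<Upsilon> (map_arg j (\<lambda>f. mult_coord i (heav r) (slice i c f)) x) \<noteq> 0}"
    have "countable N"
      unfolding N_def by (rule countable_subset[OF _ countable_jump_points[OF \<Upsilon> good kills]]) auto
    \<comment> \<open>Adding 0 makes the set nonempty, so that an infinite sequence can enumerate
      it.\<close>
    define e where "e = from_nat_into (insert 0 N)"
    have range_e: "range e = insert 0 N"
      unfolding e_def using \<open>countable N\<close> by (intro range_from_nat_into) auto
    have e01: "range e \<subseteq> {0..1}" unfolding range_e by (auto simp: N_def)
    have lim: "(\<lambda>n. \<Upsilon> (map_arg j (jump_sum i e n) x)) \<longlonglongrightarrow> \<Upsilon> x" for x
    proof -
      have "(\<lambda>n. \<Upsilon> (x(j := jump_sum i e n (x j)))) \<longlonglongrightarrow> \<Upsilon> (x(j := x j))"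
      proof (rule jump_sum_tendsto[of "\<lambda>f. \<Upsilon> (x(j := f))", OF _ _ e01])
        show "bounded_linear (\<lambda>f. \<Upsilon> (x(j := f)))" by (rule bounded_multilinear_bounded_linear[OF \<Upsilon>])
        show cont: "\<Upsilon> (x(j := f)) = 0" if "f \<in> coord_cont i" for f
          using kills that by (simp add: kills_cont_def)
        fix s c :: real and f assume c: "c \<in> {0..1}" and s: "s \<notin> range e"
        \<comment> \<open>\<open>N\<close> records jump points in [0,1] only. Outside,
          \<open>heav s\<close> is constant on the cube: 1 on the left, which is continuous, and 0
          on the right.\<close>
        consider "s < 0" | "s > 1" | "s \<in> {0..1}" by fastforce
        then show "\<Upsilon> (x(j := mult_coord i (heav s) (slice i c f))) = 0"
        proof cases
          case 1
          then show ?thesis by (intro cont coord_cont_heav c) simp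
        next
          case 2
          then have "mult_coord i (heav s) (slice i c f) = 0"
            using nth_mem_cube[of _ i] by (intro dspace_eqI) (force simp: heav_def)
          then show ?thesis using linear_0[OF bounded_multilinear_linear[OF \<Upsilon>, of x j]] by simp
        next
          case 3
          then have "\<Upsilon> (map_arg j (\<lambda>f. mult_coord i (heav s) (slice i c f)) (x(j := f))) = 0"
            using s c unfolding range_e N_def by blast
          then show ?thesis by (simp add: map_arg_def)
        qed
      qed
      then show ?thesis by (simp add: map_arg_def)
    qed
    show ?thesis
    proof (rule borel_measurable_LIMSEQ_real[OF lim])
      fix n
      define d where "d r = max 0 (r - 1 / real (Suc n))" for r
      have d: "r \<in> {0..1}" "d r \<in> {0..1}" if "r \<in> e ` {..n}" for r
      proof -
        show r: "r \<in> {0..1}" using e01 that by blast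
        have "0 \<le> 1 / real (Suc n)" by simp
        then have "r - 1 / real (Suc n) \<le> 1" using r unfolding atLeastAtMost_iff by linarith
        then show "d r \<in> {0..1}" by (simp add: d_def)
      qed
      have "\<Upsilon> (map_arg j (jump_sum i e n) x) =
          (\<Sum>r\<in>e ` {..n}. \<Upsilon> (map_arg j (\<lambda>f. mult_coord i (heav r) (slice i r f)) x)
            - \<Upsilon> (map_arg j (\<lambda>f. mult_coord i (heav r) (slice i (d r) f)) x))" for x
      proof -
        have lin: "linear (\<lambda>y. \<Upsilon> (x(j := y)))" by (rule bounded_multilinear_linear[OF \<Upsilon>])
        show ?thesis
          unfolding map_arg_def jump_sum_def d_def[symmetric]
          by (simp only: linear_sum[OF lin] linear_diff[OF lin]
              linear_diff[OF bounded_linear.linear[OF bounded_linear_heav]])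
      qed
      moreover have "(\<lambda>x. \<Sum>r\<in>e ` {..n}. \<Upsilon> (map_arg j (\<lambda>f. mult_coord i (heav r) (slice i r f)) x)
            - \<Upsilon> (map_arg j (\<lambda>f. mult_coord i (heav r) (slice i (d r) f)) x))
          \<in> borel_measurable (\<Pi>\<^sub>M i\<in>UNIV. evaluation_algebra)"
        by (intro borel_measurable_sum borel_measurable_diff cut d)
      ultimately show "(\<lambda>x. \<Upsilon> (map_arg j (jump_sum i e n) x))
          \<in> borel_measurable (\<Pi>\<^sub>M i\<in>UNIV. evaluation_algebra)" by presburger
    qed
  qed
qed

theorem theorem5p2:
  fixes \<Upsilon> :: "('l::finite \<Rightarrow> 'm::finite dspace) \<Rightarrow> real"
  assumes "bounded_multilinear \<Upsilon>"
  shows "\<Upsilon> \<in> measurable (\<Pi>\<^sub>M i\<in>UNIV. evaluation_algebra) borel"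
  using assms
proof (induction "card {q. \<not> fixed_slice \<Upsilon> q \<and> \<not> kills_cont \<Upsilon> q}" arbitrary: \<Upsilon> rule: less_induct)
  case less
  note \<Upsilon> = less.prems
  show ?case
  proof (cases "\<forall>q. fixed_slice \<Upsilon> q \<or> kills_cont \<Upsilon> q")
    case True
    then show ?thesis by (intro jump_form_measurable[OF \<Upsilon>]) blast
  next
    case False
    then obtain j i where p: "\<not> fixed_slice \<Upsilon> (j, i)" "\<not> kills_cont \<Upsilon> (j, i)" by auto
    \<comment> \<open>The induction counts pairs of neither type. It applies to any form that gives
      \<open>(j, i)\<close> a type and keeps the types of the other pairs.\<close>
    have decrease: "\<Lambda> \<in> borel_measurable (\<Pi>\<^sub>M i\<in>UNIV. evaluation_algebra)"
      if \<Lambda>: "bounded_multilinear \<Lambda>" and new: "fixed_slice \<Lambda> (j, i) \<or> kills_cont \<Lambda> (j, i)"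
        and old: "\<And>q. q \<noteq> (j, i) \<Longrightarrow> fixed_slice \<Upsilon> q \<Longrightarrow> fixed_slice \<Lambda> q"
          "\<And>q. q \<noteq> (j, i) \<Longrightarrow> kills_cont \<Upsilon> q \<Longrightarrow> kills_cont \<Lambda> q" for \<Lambda>
    proof (rule less.hyps[OF _ \<Lambda>])
      have "{q. \<not> fixed_slice \<Lambda> q \<and> \<not> kills_cont \<Lambda> q} \<subseteq> {q. \<not> fixed_slice \<Upsilon> q \<and> \<not> kills_cont \<Upsilon> q}"
      proof
        fix q assume "q \<in> {q. \<not> fixed_slice \<Lambda> q \<and> \<not> kills_cont \<Lambda> q}"
        then show "q \<in> {q. \<not> fixed_slice \<Upsilon> q \<and> \<not> kills_cont \<Upsilon> q}"
          using p old[of q] by (cases "q = (j, i)") auto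
      qed
      then have "{q. \<not> fixed_slice \<Lambda> q \<and> \<not> kills_cont \<Lambda> q} \<subset> {q. \<not> fixed_slice \<Upsilon> q \<and> \<not> kills_cont \<Upsilon> q}"
        using new p by blast
      then show "card {q. \<not> fixed_slice \<Lambda> q \<and> \<not> kills_cont \<Lambda> q} < card {q. \<not> fixed_slice \<Upsilon> q \<and> \<not> kills_cont \<Upsilon> q}"
        by (intro psubset_card_mono) auto
    qed
    have cut: "(\<lambda>x. \<Upsilon> (map_arg j (\<lambda>f. mult_coord i (heav r) (slice i c f)) x))
        \<in> borel_measurable (\<Pi>\<^sub>M i\<in>UNIV. evaluation_algebra)" if c: "c \<in> {0..1}" for r c
      by (intro decrease bounded_multilinear_map_arg[OF \<Upsilon>] disjI1 fixed_slice_map_arg_slice[OF c]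
          coord_op_bounded_linear[OF coord_op_heav_slice[OF c]]
          fixed_slice_map_arg[OF coord_op_heav_slice[OF c]] kills_cont_map_arg[OF coord_op_heav_slice[OF c]])
    define A where "A n x = \<Upsilon> (map_arg j (dyapp i n) x)" for n x
    define \<Lambda> where "\<Lambda> x = lim (\<lambda>n. A n x)" for x
    have lim: "(\<lambda>n. A n x) \<longlonglongrightarrow> \<Lambda> x" for x
      unfolding \<Lambda>_def A_def map_arg_def convergent_LIMSEQ_iff[symmetric]
      by (rule dyapp_convergent[OF bounded_multilinear_bounded_linear[OF \<Upsilon>]])
    have dyapp: "coord_op i (dyapp i n)" for n by (rule coord_op_dyapp)
    have "A n \<in> borel_measurable (\<Pi>\<^sub>M i\<in>UNIV. evaluation_algebra)" for n
    proof -
      \<comment> \<open>The approximants are finite combinations of cut forms frozen at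
        \<open>(j, i)\<close>, so they are measurable by the induction hypothesis, and \<Lambda> is
        measurable as their limit.\<close>
      let ?D = "dyadic n" and ?u = "unext (dyadic n)"
      have "A n x = (\<Sum>s\<in>?D. \<Upsilon> (map_arg j (\<lambda>f. mult_coord i (heav s) (slice i (?u s) f)) x)
            - \<Upsilon> (map_arg j (\<lambda>f. mult_coord i (heav (nxt ?D s)) (slice i (?u s) f)) x))" for x
      proof -
        have lin: "linear (\<lambda>y. \<Upsilon> (x(j := y)))" by (rule bounded_multilinear_linear[OF \<Upsilon>])
        show ?thesis
          unfolding A_def map_arg_def dyapp_def step_def
          by (simp only: linear_sum[OF lin] linear_diff[OF lin])
      qed
      then have "A n = (\<lambda>x. \<Sum>s\<in>?D. \<Upsilon> (map_arg j (\<lambda>f. mult_coord i (heav s) (slice i (?u s) f)) x)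
            - \<Upsilon> (map_arg j (\<lambda>f. mult_coord i (heav (nxt ?D s)) (slice i (?u s) f)) x))" by (rule ext)
      then show ?thesis
        by (rule ssubst) (intro borel_measurable_sum borel_measurable_diff cut unext(1)[OF dyadic(1,3)])
    qed
    then have \<Lambda>_meas: "\<Lambda> \<in> borel_measurable (\<Pi>\<^sub>M i\<in>UNIV. evaluation_algebra)"
      by (rule borel_measurable_LIMSEQ_real[OF lim])
    obtain C where C: "C \<ge> 0" "\<And>x. norm (\<Upsilon> x) \<le> C * (\<Prod>i\<in>UNIV. norm (x i))"
      using bounded_multilinear_bound[OF \<Upsilon>] by blast
    have \<Lambda>: "bounded_multilinear \<Lambda>"
    proof (rule bounded_multilinear_tendsto[OF _ _ lim])
      show "linear (\<lambda>y. A n (x(k := y)))" for n k x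
        unfolding A_def by (rule linear_map_arg[OF \<Upsilon> bounded_linear.linear[OF coord_op_bounded_linear[OF dyapp]]])
      fix n x
      have "norm (A n x) \<le> C * (\<Prod>k\<in>UNIV. norm (map_arg j (dyapp i n) x k))"
        unfolding A_def by (rule C(2))
      also have "\<dots> \<le> C * (1 * (\<Prod>k\<in>UNIV. norm (x k)))"
        by (intro mult_left_mono prod_norm_map_arg_le C(1)) (simp add: norm_dyapp_le)
      finally show "norm (A n x) \<le> C * (\<Prod>k\<in>UNIV. norm (x k))" by simp
    qed
    have \<Lambda>_eq: "\<Lambda> x = \<Lambda> y" if "\<And>n. A n x = A n y" for x y
      using that by (simp add: \<Lambda>_def)
    have "(\<lambda>x. \<Upsilon> x - \<Lambda> x) \<in> borel_measurable (\<Pi>\<^sub>M i\<in>UNIV. evaluation_algebra)"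
    proof (rule decrease)
      show "bounded_multilinear (\<lambda>x. \<Upsilon> x - \<Lambda> x)" by (rule bounded_multilinear_diff[OF \<Upsilon> \<Lambda>])
      \<comment> \<open>For such an argument the approximants converge in norm, so \<Upsilon> passes
        to the limit and \<Lambda> agrees with it.\<close>
      have "\<Upsilon> x - \<Lambda> x = 0" if "x j \<in> coord_cont i" for x
      proof -
        have "(\<lambda>n. \<Upsilon> (x(j := dyapp i n (x j)))) \<longlonglongrightarrow> \<Upsilon> (x(j := x j))"
          using that by (intro bounded_linear.tendsto[OF bounded_multilinear_bounded_linear[OF \<Upsilon>]])
            (simp add: coord_cont_def)
        then have "(\<lambda>n. A n x) \<longlonglongrightarrow> \<Upsilon> x" by (simp add: A_def map_arg_def)
        from LIMSEQ_unique[OF this lim] show ?thesis by simp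
      qed
      then show "fixed_slice (\<lambda>x. \<Upsilon> x - \<Lambda> x) (j, i) \<or> kills_cont (\<lambda>x. \<Upsilon> x - \<Lambda> x) (j, i)"
        by (auto simp: kills_cont_def)
      fix q assume q: "q \<noteq> (j, i)"
      obtain k l where kl: "q = (k, l)" by (cases q)
      show "fixed_slice (\<lambda>x. \<Upsilon> x - \<Lambda> x) q" if fixed: "fixed_slice \<Upsilon> q"
      proof -
        obtain c where c: "c \<in> {0..1}" "\<And>x. \<Upsilon> (map_arg k (slice l c) x) = \<Upsilon> x"
          using fixed by (auto simp: fixed_slice_def kl)
        have "map_arg j (dyapp i n) (map_arg k (slice l c) x) = map_arg k (slice l c) (map_arg j (dyapp i n) x)" for n x
          using q by (intro map_arg_commute coord_op_slice_commute[OF dyapp _ c(1)]) (auto simp: kl)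
        then have "\<Lambda> (map_arg k (slice l c) x) = \<Lambda> x" for x
          by (intro \<Lambda>_eq) (simp add: A_def c(2))
        then show ?thesis
          unfolding fixed_slice_def kl prod.case using c by (intro bexI[of _ c] allI) simp_all
      qed
      show "kills_cont (\<lambda>x. \<Upsilon> x - \<Lambda> x) q" if kills: "kills_cont \<Upsilon> q"
      proof -
        have "\<Lambda> x = 0" if "x k \<in> coord_cont l" for x
        proof -
          have "A n x = 0" for n
            using kills_cont_map_arg[OF dyapp q kills] that by (simp add: A_def kills_cont_def kl)
          then show ?thesis using LIMSEQ_unique[OF lim[of x]] by simp
        qed
        then show ?thesis using kills by (auto simp: kills_cont_def kl)
      qed
    qed
    from borel_measurable_add[OF this \<Lambda>_meas] show ?thesis by simp
  qed
qed

end
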